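(* Statement (P) below implies statement (W) below. (P) (Polynomial Freiman--Ruzsa conjecture over $\mathbf{F}_2$.) There is an absolute constant $c>0$ such that, for every $D$, every $K$ and every non-empty $A\subseteq \mathbf{F}_2^D$ with $\sigma[A]\leq K$, the set $A$ is covered by at most $\exp(c\log(2K))$ cosets of some subspace $H\leq\mathbf{F}_2^D$ of size at most $|A|$. (W) (Weak Polynomial Freiman--Ruzsa conjecture over $\mathbf{Z}$.) There are absolute constants $C, C'$ such that, for every $D$, every $K$ and every finite non-empty set $A\subseteq\mathbf{Z}^D$ with $\sigma[A]\leq K$, there is a subset $A'\subseteq A$ with $|A'|\geq K^{-C}|A|$ and $\dim A'\leq C'\log K$.
   Context: For a finite non-empty subset $A$ of an abelian group, $\sigma[A] = |A+A|/|A|$ is its doubling constant. For $A\subseteq\mathbf{Z}^D$, $\dim A$ is the (affine) dimension of $A$, i.e. the dimension of the real span of $A-A$. $\log$ is the natural logarithm. Absolute constants do not depend on $D$, $K$ or $A$. *)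

theory Defs
  imports
    Complex_Main
    "HOL-Library.Z2"
    "HOL-Library.Function_Algebras"
    "HOL-Library.Set_Algebras"
begin

(* The dimension D is quantified inside the two conjectures, so R^D is carried by the sequences
   nat => R supported on the indices {..<D}.  Addition of sequences is pointwise
   (Function_Algebras), and A + B for sets is the sumset (Set_Algebras). *)

definition coord_space :: "nat \<Rightarrow> (nat \<Rightarrow> 'a::zero) set" where
  "coord_space D = {x. \<forall>i\<ge>D. x i = 0}"

definition scale_seq :: "'a::field \<Rightarrow> (nat \<Rightarrow> 'a) \<Rightarrow> (nat \<Rightarrow> 'a)" where
  "scale_seq c x = (\<lambda>i. c * x i)"

interpretation seq: vector_space "scale_seq :: 'a::field \<Rightarrow> (nat \<Rightarrow> 'a) \<Rightarrow> (nat \<Rightarrow> 'a)"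
  by unfold_locales (auto simp: scale_seq_def fun_eq_iff algebra_simps)

definition doubling :: "'a::ab_group_add set \<Rightarrow> real" where
  "doubling A = real (card (A + A)) / real (card A)"

(* seq.dim S is the dimension of the linear span of S.  The difference set is written out because
   A - A denotes the set-theoretic difference. *)
definition affine_dim :: "(nat \<Rightarrow> int) set \<Rightarrow> nat" where
  "affine_dim A =
     seq.dim {(\<lambda>i. real_of_int (x i - y i)) | x y. x \<in> A \<and> y \<in> A}"

definition PFR_F2 :: bool where
  "PFR_F2 \<longleftrightarrow>
     (\<exists>c::real. c > 0 \<and>
       (\<forall>(D::nat) (K::real) (A :: (nat \<Rightarrow> bit) set).
          A \<subseteq> coord_space D \<longrightarrow> A \<noteq> {} \<longrightarrow> doubling A \<le> K \<longrightarrow>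
          (\<exists>H \<C>. seq.subspace H \<and> H \<subseteq> coord_space D \<and> card H \<le> card A \<and>
             \<C> \<subseteq> {x +o H | x. x \<in> coord_space D} \<and> finite \<C> \<and>
             real (card \<C>) \<le> exp (c * ln (2 * K)) \<and> A \<subseteq> \<Union>\<C>)))"

definition weak_PFR_Z :: bool where
  "weak_PFR_Z \<longleftrightarrow>
     (\<exists>C C' :: real.
       (\<forall>(D::nat) (K::real) (A :: (nat \<Rightarrow> int) set).
          A \<subseteq> coord_space D \<longrightarrow> finite A \<longrightarrow> A \<noteq> {} \<longrightarrow> doubling A \<le> K \<longrightarrow>
          (\<exists>A'. A' \<subseteq> A \<and> real (card A') \<ge> K powr (- C) * real (card A) \<and>
             real (affine_dim A') \<le> C' * ln K)))"

end

theory Submission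
  imports Defs
begin

text \<open>
  Fix \<open>\<theta>\<close> slightly above \<open>1/2\<close> and let \<open>(A', B')\<close> minimise \<open>|S + T| / (|S| |T|)\<^sup>\<theta>\<close> over nonempty
  subsets of \<open>A\<close>. Minimality keeps \<open>A'\<close> polynomially large in \<open>A\<close> and, summing over disjoint sumsets
  of fibres, yields \<open>\<Sum>\<^sub>z (a(x\<^sub>z) b(y\<^sub>z))\<^sup>\<theta> \<le> 1\<close> whenever \<open>x\<^sub>z + y\<^sub>z = z\<close>, where \<open>a, b\<close> are the fibre densities of
  \<open>A', B'\<close> under any homomorphism. Choose coordinates in which \<open>A' - A'\<close> and \<open>B' - B'\<close> generate the whole
  lattice \<open>\<int>\<^sup>I\<close>, and reduce modulo 2.

  With all \<open>y\<^sub>z\<close> equal, the inequality says that the Renyi entropies of \<open>a\<close> and \<open>b\<close> of orders between \<open>\<theta>\<close> and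
  infinity nearly coincide, so large level sets of \<open>a\<close> have small doubling and PFR gives a subgroup \<open>H\<close>,
  with \<open>log |H|\<close> at most twice the min-entropy of \<open>a\<close>, modulo which that min-entropy drops by a factor
  of 4. For a homomorphism onto \<open>\<int>/2\<close> the inequality forces both fibres of \<open>A'\<close> to be nearly
  half of it; averaging over all characters, the min-entropy is large in every quotient of large
  dimension, so the iteration continues until only boundedly many dimensions remain. Hence \<open>|I|\<close> is
  \<open>O(1)\<close> plus a multiple of the initial min-entropy, which is \<open>O(log K)\<close> because
  \<open>|A' mod 2| |A'| \<le> |A' + 2A'| \<le> |A' + A' + A'|\<close>.
\<close>

section \<open>Sumset inequalities\<close>

lemma finite_sumset: "finite A \<Longrightarrow> finite B \<Longrightarrow> finite (A + B)"
  for A B :: "'a::ab_group_add set"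
  by (simp add: set_plus_image)

lemma card_translate: "card ((+) a ` A) = card A" for a :: "'a::ab_group_add"
  by (rule card_image) simp

lemma card_le_sumset:
  fixes A B :: "'a::ab_group_add set"
  assumes "finite A" "finite B" "B \<noteq> {}"
  shows "card A \<le> card (A + B)"
proof -
  obtain b where "b \<in> B" using assms by auto
  have "card ((+) b ` A) \<le> card (A + B)"
    using \<open>b \<in> B\<close> assms by (intro card_mono finite_sumset) (auto simp: set_plus_def add.commute)
  then show ?thesis by (simp only: card_translate)
qed

text \<open>Ruzsa's injection: fix one representation \<open>w = f w + g w\<close> of each element
  of \<open>Y + Z\<close> and send \<open>(x, w)\<close> to \<open>(f w - x, x + g w)\<close>.
  Adding the two entries recovers \<open>w\<close>, and then \<open>x\<close>.\<close>

lemma ruzsa_triangle: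
  fixes X Y Z :: "'a::ab_group_add set"
  assumes "finite X" "finite Y" "finite Z"
  shows "card X * card (Y + Z) \<le> card (Y + uminus ` X) * card (X + Z)"
proof -
  have "\<forall>w\<in>Y + Z. \<exists>y z. y \<in> Y \<and> z \<in> Z \<and> w = y + z" by (auto simp: set_plus_def)
  then obtain f g where fg: "\<And>w. w \<in> Y + Z \<Longrightarrow> f w \<in> Y \<and> g w \<in> Z \<and> w = f w + g w"
    by metis
  let ?h = "\<lambda>(x, w). (f w - x, x + g w)"
  have "card (X \<times> (Y + Z)) \<le> card ((Y + uminus ` X) \<times> (X + Z))"
  proof (rule card_inj_on_le)
    show "inj_on ?h (X \<times> (Y + Z))"
    proof (rule inj_onI, clarify)
      fix x w x' w'
      assume *: "w \<in> Y + Z" "w' \<in> Y + Z" "f w - x = f w' - x'" "x + g w = x' + g w'"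
      then have "f w + g w = f w' + g w'"
        by (metis (no_types, opaque_lifting) diff_add_cancel add.assoc)
      with fg * have "w = w'" by metis
      with * show "x = x' \<and> w = w'" by simp
    qed
    have "f w - x \<in> Y + uminus ` X" if "x \<in> X" "w \<in> Y + Z" for x w
      using set_plus_intro[of "f w" Y "- x" "uminus ` X"] fg[OF that(2)] that(1) by simp
    then show "?h ` (X \<times> (Y + Z)) \<subseteq> (Y + uminus ` X) \<times> (X + Z)"
      using fg by (auto simp: split_def)
    show "finite ((Y + uminus ` X) \<times> (X + Z))"
      using assms by (simp add: finite_sumset)
  qed
  then show ?thesis by (simp add: card_cartesian_product)
qed

lemma uminus_sumset: "uminus ` (A + B) = uminus ` A + uminus ` B"
  for A B :: "'a::ab_group_add set"
  by (fastforce simp: set_plus_def image_iff)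

text \<open>Petridis's lemma; the hypotheses say that \<open>X\<close> minimises \<open>card (Y + B) / card Y\<close> among its subsets.\<close>

lemma petridis:
  fixes X B C :: "'a::ab_group_add set" and k :: real
  assumes k0: "k \<ge> 0" and fin: "finite X" "finite B" "finite C" and k: "real (card (X + B)) = k * card X"
    and min: "\<And>Y. Y \<subseteq> X \<Longrightarrow> k * card Y \<le> card (Y + B)"
  shows "real (card (X + B + C)) \<le> k * card (X + C)"
  using fin(3)
proof induction
  case empty
  then show ?case by (simp add: set_plus_def)
next
  case (insert x C)
  let ?T = "\<lambda>S. (+) x ` S"
  \<comment> \<open>For \<open>y\<close> in \<open>X'\<close> the whole translate
    \<open>x + y + B\<close> is already in \<open>X + B + C\<close>. Minimality is applied to
    \<open>X'\<close>, whereas \<open>W\<close> counts the overlap of \<open>x + X\<close> with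
    \<open>X + C\<close> exactly.\<close>
  define X' where "X' = {y\<in>X. ?T ((+) y ` B) \<subseteq> X + B + C}"
  define W where "W = {y\<in>X. x + y \<in> X + C}"
  have fX': "finite X'" "X' \<subseteq> X" and fW: "finite W" "W \<subseteq> X"
    using fin by (auto simp: X'_def W_def)
  have "W \<subseteq> X'"
  proof
    fix y assume "y \<in> W"
    then obtain u c where "y \<in> X" "u \<in> X" "c \<in> C" "x + y = u + c"
      by (auto simp: W_def set_plus_def)
    then have "x + (y + b) = u + b + c" for b
      by (simp add: add.commute add.left_commute flip: add.assoc[of x y b])
    then have "x + (y + b) \<in> X + B + C" if "b \<in> B" for b
      using that \<open>u \<in> X\<close> \<open>c \<in> C\<close> by (simp only: set_plus_intro)
    then show "y \<in> X'" using \<open>y \<in> X\<close> by (auto simp: X'_def)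
  qed
  have 1: "X + B + insert x C \<subseteq> (X + B + C) \<union> ?T (X + B - (X' + B))"
  proof
    fix z assume "z \<in> X + B + insert x C"
    then obtain u b c where z: "z = u + b + c" "u \<in> X" "b \<in> B" "c = x \<or> c \<in> C"
      by (auto simp: set_plus_def)
    show "z \<in> (X + B + C) \<union> ?T (X + B - (X' + B))"
    proof (cases "c \<in> C \<or> u + b \<in> X' + B")
      case True
      then show ?thesis
      proof
        assume "u + b \<in> X' + B"
        then obtain u' b' where "u' \<in> X'" "b' \<in> B" "u + b = u' + b'"
          by (auto simp: set_plus_def)
        then have "x + (u + b) \<in> X + B + C" by (auto simp: X'_def)
        then show ?thesis using z by (auto simp: add.commute)
      qed (use z in auto)
    next
      case False
      then show ?thesis using z by (auto simp: add.commute)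
    qed
  qed
  have "card (X + B + insert x C) \<le> card (X + B + C) + card (X + B - (X' + B))"
    using card_mono[OF _ 1] card_Un_le[of "X + B + C" "?T (X + B - (X' + B))"] fin insert(1)
    by (simp add: finite_sumset card_translate)
  also have "card (X + B - (X' + B)) = card (X + B) - card (X' + B)"
    using fX' fin by (intro card_Diff_subset finite_sumset set_plus_mono2) auto
  finally have "real (card (X + B + insert x C)) \<le> card (X + B + C) + (real (card (X + B)) - card (X' + B))"
    using card_mono[OF _ set_plus_mono2[OF fX'(2) order_refl], of B] fin by (simp add: finite_sumset)
  also have "\<dots> \<le> k * card (X + C) + (k * card X - k * card X')"
    using insert.IH min[OF fX'(2)] k by simp
  also have "\<dots> \<le> k * (card (X + C) + (real (card X) - card W))"
    using card_mono[OF fX'(1) \<open>W \<subseteq> X'\<close>] k0 by (simp add: algebra_simps mult_left_mono)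
  also have "card (X + C) + (real (card X) - card W) = card ((X + C) \<union> ?T (X - W))"
  proof -
    have "(X + C) \<inter> ?T (X - W) = {}" by (auto simp: W_def)
    then have "card ((X + C) \<union> ?T (X - W)) = card (X + C) + card (X - W)"
      using fin insert(1) by (subst card_Un_disjoint) (auto simp: finite_sumset card_translate)
    then show ?thesis
      using fW card_mono[OF fin(1) fW(2)] by (simp add: card_Diff_subset of_nat_diff)
  qed
  also have "k * card ((X + C) \<union> ?T (X - W)) \<le> k * card (X + insert x C)"
  proof -
    have "(X + C) \<union> ?T (X - W) \<subseteq> X + insert x C"
      by (auto simp: set_plus_def add.commute)
    then show ?thesis
      using k0 fin insert(1) by (intro mult_left_mono of_nat_mono card_mono finite_sumset) auto
  qed
  finally show ?case .
qed

text \<open>A Pluennecke-type bound. Petridis's lemma for the subset \<open>X\<close> with smallest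
  ratio \<open>card (X + A) / card X\<close> gives
  \<open>card (X + (A + A)) \<le> K ^ 2 * card X\<close>. Two triangle inequalities, the second
  through \<open>X\<close>, replace \<open>X\<close> by \<open>A\<close> at the cost of another
  \<open>K ^ 2\<close>.\<close>

lemma card_triple_sumset_le:
  fixes A :: "'a::ab_group_add set" and K :: real
  assumes A: "finite A" "A \<noteq> {}" and K: "real (card (A + A)) \<le> K * card A"
  shows "real (card (A + (A + A))) \<le> K ^ 4 * card A"
proof -
  have A0: "real (card A) > 0" using A by (simp add: card_gt_0_iff)
  have "card A \<le> card (A + A)" using A by (intro card_le_sumset)
  then have "1 * real (card A) \<le> K * card A" using K by simp
  then have K1: "K \<ge> 1" using A0 by (simp only: mult_le_cancel_right_pos)
  define r where "r X = real (card (X + A)) / card X" for X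
  define P where "P = Pow A - {{}}"
  have "finite P" "P \<noteq> {}" using A by (auto simp: P_def)
  then obtain X where X: "X \<in> P" "\<And>Y. Y \<in> P \<Longrightarrow> r X \<le> r Y"
    using ex_is_arg_min_if_finite[of P r] by (auto simp: is_arg_min_linorder)
  have XA: "X \<subseteq> A" "X \<noteq> {}" "finite X" using X A finite_subset by (auto simp: P_def)
  have X0: "real (card X) > 0" using XA by (simp add: card_gt_0_iff)
  have rK: "r X \<le> K"
  proof -
    have "r X \<le> r A" using X(2) A by (simp add: P_def)
    also have "r A \<le> K" using K A0 by (simp add: r_def pos_divide_le_eq)
    finally show ?thesis .
  qed
  have r0: "r X \<ge> 0" by (simp add: r_def)
  have kX: "real (card (X + A)) = r X * card X" using X0 by (simp add: r_def)
  have min: "r X * card Y \<le> card (Y + A)" if "Y \<subseteq> X" for Y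
  proof (cases "Y = {}")
    case False
    then have "r X \<le> r Y" using X(2) that XA by (auto simp: P_def)
    moreover have "card Y > 0" using False that XA finite_subset by (auto simp: card_gt_0_iff)
    ultimately show ?thesis by (simp add: r_def field_simps)
  qed simp
  have "real (card (X + (A + A))) \<le> r X * card (X + A)"
    using petridis[OF r0 XA(3) A(1) A(1) kX min] by (simp add: add.assoc)
  also have "\<dots> = r X ^ 2 * card X" using kX by (simp add: power2_eq_square)
  also have "\<dots> \<le> K ^ 2 * card X" using rK r0 by (intro mult_right_mono power_mono) auto
  finally have t1: "real (card (X + (A + A))) \<le> K ^ 2 * card X" .
  \<comment> \<open>The triangle inequality through \<open>- A\<close> turns the sumset bound into a
    bound for the difference set.\<close>
  have "card (uminus ` A) * card (A + uminus ` A)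
      \<le> card (A + uminus ` uminus ` A) * card (uminus ` A + uminus ` A)"
    using A by (intro ruzsa_triangle) auto
  then have "card A * card (A + uminus ` A) \<le> card (A + A) * card (A + A)"
    by (simp add: image_image card_image flip: uminus_sumset)
  then have "real (card A) * card (A + uminus ` A) \<le> real (card (A + A)) * card (A + A)"
    by (metis of_nat_le_iff of_nat_mult)
  also have "\<dots> \<le> (K * card A) * (K * card A)" using K by (intro mult_mono) auto
  finally have "real (card A) * card (A + uminus ` A) \<le> card A * (K ^ 2 * card A)"
    by (simp add: power2_eq_square mult_ac)
  then have t2: "real (card (A + uminus ` A)) \<le> K ^ 2 * card A" using A0 by simp
  have "card (A + uminus ` X) \<le> card (A + uminus ` A)"
    using A XA by (intro card_mono finite_sumset set_plus_mono2) auto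
  then have t3: "real (card (A + uminus ` X)) \<le> K ^ 2 * card A" using t2 by linarith
  have "card X * card (A + (A + A)) \<le> card (A + uminus ` X) * card (X + (A + A))"
    using A XA by (intro ruzsa_triangle) (auto simp: finite_sumset)
  then have "real (card X) * card (A + (A + A)) \<le> real (card (A + uminus ` X)) * card (X + (A + A))"
    by (metis of_nat_le_iff of_nat_mult)
  also have "\<dots> \<le> (K ^ 2 * card A) * (K ^ 2 * card X)"
    using t1 t3 K1 by (intro mult_mono) auto
  also have "\<dots> = card X * (K ^ 4 * card A)" by (simp add: power_numeral_reduce)
  finally show ?thesis using X0 by simp
qed

section \<open>Fibre densities of a regular pair\<close>

declare add_bit_eq_xor [simp del] mult_bit_eq_and [simp del]

text \<open>The law of \<open>\<psi>\<close> at a uniformly random element of \<open>A\<close>; the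
  entropies in the argument are those of this distribution.\<close>

definition wt :: "'a set \<Rightarrow> ('a \<Rightarrow> 'b) \<Rightarrow> 'b \<Rightarrow> real" where
  "wt A \<psi> x = card {a\<in>A. \<psi> a = x} / card A"

text \<open>Minimality of \<open>card (S + T) / (card S * card T) powr \<theta>\<close> at
  \<open>(A, B)\<close>, rewritten in terms of relative densities, which for fibres are the weights
  \<open>wt\<close>.\<close>

definition regular_pair :: "real \<Rightarrow> 'a::ab_group_add set \<Rightarrow> 'a set \<Rightarrow> bool" where
  "regular_pair \<theta> A B \<longleftrightarrow> finite A \<and> finite B \<and> A \<noteq> {} \<and> B \<noteq> {} \<and>
     (\<forall>S T. S \<subseteq> A \<longrightarrow> T \<subseteq> B \<longrightarrow> S \<noteq> {} \<longrightarrow> T \<noteq> {} \<longrightarrow>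
        card (A + B) * (card S / card A * (card T / card B)) powr \<theta> \<le> card (S + T))"

lemma regular_pairD:
  assumes "regular_pair \<theta> A B"
  shows "finite A" "finite B" "A \<noteq> {}" "B \<noteq> {}"
    and "\<And>S T. S \<subseteq> A \<Longrightarrow> T \<subseteq> B \<Longrightarrow> S \<noteq> {} \<Longrightarrow> T \<noteq> {} \<Longrightarrow>
        card (A + B) * (card S / card A * (card T / card B)) powr \<theta> \<le> card (S + T)"
  using assms unfolding regular_pair_def by blast+

lemma regular_pair_commute: "regular_pair \<theta> A B \<Longrightarrow> regular_pair \<theta> B A"
  unfolding regular_pair_def by (metis add.commute mult.commute)

lemma wt_nonneg [simp]: "0 \<le> wt A \<psi> x"
  by (simp add: wt_def)

lemma wt_pos: "finite A \<Longrightarrow> x \<in> \<psi> ` A \<Longrightarrow> 0 < wt A \<psi> x"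
  by (auto simp: wt_def card_gt_0_iff intro!: divide_pos_pos)

lemma sum_wt:
  assumes "finite A" "A \<noteq> {}" "finite Y" "\<psi> ` A \<subseteq> Y"
  shows "(\<Sum>y\<in>Y. wt A \<psi> y) = 1"
proof -
  have "(\<Sum>y\<in>Y. card {a\<in>A. \<psi> a = y}) = card (\<Union>y\<in>Y. {a\<in>A. \<psi> a = y})"
    using assms by (intro card_UN_disjoint[symmetric]) auto
  also have "(\<Union>y\<in>Y. {a\<in>A. \<psi> a = y}) = A" using assms by auto
  finally have "(\<Sum>y\<in>Y. real (card {a\<in>A. \<psi> a = y})) = card A" by (metis of_nat_sum)
  then show ?thesis using assms by (simp add: wt_def flip: sum_divide_distrib)
qed

lemma sum_wt_le:
  assumes "finite A" "A \<noteq> {}" "finite Y"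
  shows "(\<Sum>y\<in>Y. wt A \<psi> y) \<le> 1"
proof -
  have "(\<Sum>y\<in>Y. wt A \<psi> y) \<le> (\<Sum>y\<in>Y \<union> \<psi> ` A. wt A \<psi> y)"
    using assms by (intro sum_mono2) auto
  also have "\<dots> = 1" using assms by (intro sum_wt) auto
  finally show ?thesis .
qed

lemma wt_le_1: "finite A \<Longrightarrow> A \<noteq> {} \<Longrightarrow> wt A \<psi> x \<le> 1"
  using sum_wt_le[of A "{x}"] by simp

text \<open>For distinct \<open>z\<close> the sumsets of the fibres over \<open>f z\<close> and
  \<open>g z\<close> are disjoint subsets of \<open>A + B\<close>. Regularity bounds each from
  below, and the common factor \<open>card (A + B)\<close> cancels.\<close>

lemma fibre_sum_le_1:
  assumes reg: "regular_pair \<theta> A B" and \<psi>: "Modules.additive \<psi>" and Z: "finite Z"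
    and fg: "\<And>z. z \<in> Z \<Longrightarrow> f z + g z = z"
  shows "(\<Sum>z\<in>Z. (wt A \<psi> (f z) * wt B \<psi> (g z)) powr \<theta>) \<le> 1"
proof -
  note AB = regular_pairD[OF reg]
  define F where "F x = {a\<in>A. \<psi> a = x}" for x
  define G where "G x = {a\<in>B. \<psi> a = x}" for x
  have fin: "finite (F x)" "finite (G x)" for x using AB by (auto simp: F_def G_def)
  have lab: "\<psi> u = z" if "u \<in> F (f z) + G (g z)" "z \<in> Z" for u z
    using that fg additive.add[OF \<psi>] by (auto simp: F_def G_def set_plus_def)
  have "card (A + B) * (\<Sum>z\<in>Z. (wt A \<psi> (f z) * wt B \<psi> (g z)) powr \<theta>)
      = (\<Sum>z\<in>Z. card (A + B) * (card (F (f z)) / card A * (card (G (g z)) / card B)) powr \<theta>)"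
    by (simp add: sum_distrib_left wt_def F_def G_def)
  also have "\<dots> \<le> (\<Sum>z\<in>Z. real (card (F (f z) + G (g z))))"
  proof (rule sum_mono)
    fix z
    show "card (A + B) * (card (F (f z)) / card A * (card (G (g z)) / card B)) powr \<theta>
        \<le> card (F (f z) + G (g z))"
    \<comment> \<open>Regularity says nothing about empty fibres, but their term vanishes since
      \<open>0 powr \<theta> = 0\<close>.\<close>
    proof (cases "F (f z) = {} \<or> G (g z) = {}")
      case False
      then show ?thesis by (intro AB(5)) (auto simp: F_def G_def)
    qed auto
  qed
  also have "\<dots> = card (\<Union>z\<in>Z. F (f z) + G (g z))"
  proof -
    have "(F (f i) + G (g i)) \<inter> (F (f j) + G (g j)) = {}" if "i \<in> Z" "j \<in> Z" "i \<noteq> j" for i j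
      using lab that by blast
    then show ?thesis using Z fin by (subst card_UN_disjoint) (simp_all add: finite_sumset)
  qed
  also have "\<dots> \<le> card (A + B)"
    using AB by (intro of_nat_mono card_mono finite_sumset UN_least set_plus_mono2)
      (auto simp: F_def G_def)
  finally have "card (A + B) * (\<Sum>z\<in>Z. (wt A \<psi> (f z) * wt B \<psi> (g z)) powr \<theta>)
      \<le> real (card (A + B)) * 1" by simp
  moreover have "card (A + B) > 0"
    using card_le_sumset[of A B] AB by (metis card_gt_0_iff order_less_le_trans)
  ultimately show ?thesis by (metis mult_le_cancel_left_pos of_nat_0_less_iff)
qed

section \<open>Homomorphisms to the group of order two\<close>

lemma bit_exhaust: "v = 0 \<or> v = (1::bit)"
  by (cases v) auto

lemma add_self_bit: "v + v = (0::bit)"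
  by (cases v) auto

lemma UNIV_bit: "(UNIV :: bit set) = {v, v + 1}"
proof (rule set_eqI)
  show "x \<in> UNIV \<longleftrightarrow> x \<in> {v, v + 1}" for x
    by (cases x; cases v) simp_all
qed

lemma wt_bit_compl:
  assumes "finite A" "A \<noteq> {}"
  shows "wt A l (v + 1 :: bit) = 1 - wt A l v"
proof -
  have "l ` A \<subseteq> {v, v + 1}" using UNIV_bit[of v] by (metis subset_UNIV)
  then have "(\<Sum>y\<in>{v, v + 1}. wt A l y) = 1" using assms by (intro sum_wt) auto
  then show ?thesis by simp
qed

text \<open>The fibre inequality with the first point fixed at \<open>v\<close> and \<open>z\<close>
  running through both bits, so that the second point takes both values.\<close>

lemma fibre_halves_le_1:
  fixes l :: "'a::ab_group_add \<Rightarrow> bit"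
  assumes reg: "regular_pair \<theta> A B" and l: "Modules.additive l"
  shows "wt A l v powr \<theta> * (wt B l w powr \<theta> + (1 - wt B l w) powr \<theta>) \<le> 1"
proof -
  note AB = regular_pairD[OF reg]
  have "(\<Sum>z\<in>{v + w, v + w + 1}. (wt A l v * wt B l (z - v)) powr \<theta>) \<le> 1"
    by (rule fibre_sum_le_1[OF reg l]) (auto simp del: minus_bit_def)
  also have "(\<Sum>z\<in>{v + w, v + w + 1}. (wt A l v * wt B l (z - v)) powr \<theta>)
      = (wt A l v * wt B l w) powr \<theta> + (wt A l v * wt B l (w + 1)) powr \<theta>"
    by (simp add: algebra_simps del: minus_bit_def)
  also have "\<dots> = wt A l v powr \<theta> * (wt B l w powr \<theta> + (1 - wt B l w) powr \<theta>)"
    using wt_le_1[OF AB(2,4), of l w]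
    by (simp add: wt_bit_compl[OF AB(2,4)] powr_mult distrib_left)
  finally show ?thesis .
qed

text \<open>The inequality contradicts \<open>fibre_halves_le_1\<close>, which excludes fibres of density above \<open>1 / 2 + \<eta>\<close>.\<close>

definition balancing :: "real \<Rightarrow> real \<Rightarrow> bool" where
  "balancing \<theta> \<eta> \<longleftrightarrow> (\<forall>a b. 1 / 2 \<le> b \<longrightarrow> b < 1 \<longrightarrow> b \<le> a \<longrightarrow> a \<le> 1 \<longrightarrow> 1 / 2 + \<eta> < a \<longrightarrow>
     1 < a powr \<theta> * (b powr \<theta> + (1 - b) powr \<theta>))"

text \<open>The case where the fibre of \<open>A\<close> is at least as dense as that of
  \<open>B\<close>. \<open>balancing\<close> needs \<open>b < 1\<close>; if \<open>wt B l w\<close>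
  were 1, both weights would be 1, which the last assumption excludes.\<close>

lemma wt_balanced_aux:
  fixes l :: "'a::ab_group_add \<Rightarrow> bit"
  assumes "regular_pair \<theta> A B" "Modules.additive l" "balancing \<theta> \<eta>"
    and "1 / 2 \<le> wt B l w" "wt B l w \<le> wt A l v" "wt B l w \<noteq> 1 \<or> wt A l v \<noteq> 1"
  shows "wt A l v \<le> 1 / 2 + \<eta>"
proof -
  note AB = regular_pairD[OF assms(1)]
  have "wt A l v \<le> 1" using AB by (simp add: wt_le_1)
  moreover have "wt B l w < 1" using assms(5,6) calculation by linarith
  ultimately show ?thesis
    using fibre_halves_le_1[OF assms(1,2), of v w] assms(3,4,5) unfolding balancing_def
    by (metis linorder_not_le)
qed

text \<open>One of the two fibres of \<open>B\<close> has density at least a half. It is compared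
  with the fibre of \<open>A\<close>, and the pair is swapped when the fibre of \<open>B\<close> is
  the denser one.\<close>

lemma wt_balanced:
  fixes l :: "'a::ab_group_add \<Rightarrow> bit"
  assumes reg: "regular_pair \<theta> A B" and l: "Modules.additive l" and bal: "balancing \<theta> \<eta>"
    and "\<eta> \<ge> 0" and nonconst: "\<And>v w. wt A l v \<noteq> 1 \<or> wt B l w \<noteq> 1"
  shows "wt A l v \<le> 1 / 2 + \<eta>"
proof (rule ccontr)
  assume a: "\<not> ?thesis"
  note AB = regular_pairD[OF reg]
  obtain w where w: "1 / 2 \<le> wt B l w"
  proof (cases "1 / 2 \<le> wt B l 0")
    case False
    then have "1 / 2 \<le> wt B l (0 + 1)" using wt_bit_compl[OF AB(2,4), of l 0] by simp
    then show ?thesis by (rule that)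
  qed (rule that)
  show False
  proof (cases "wt B l w \<le> wt A l v")
    case True
    then show False using wt_balanced_aux[OF reg l bal w] nonconst a by blast
  next
    case False
    then show False
      using wt_balanced_aux[OF regular_pair_commute[OF reg] l bal, of v w] nonconst[of v w] a \<open>\<eta> \<ge> 0\<close>
      by (auto simp: not_le)
  qed
qed

section \<open>Fourier analysis on binary spaces\<close>

definition bit_sign :: "bit \<Rightarrow> real" where
  "bit_sign v = (if v = 0 then 1 else - 1)"

lemma bit_sign_add: "bit_sign (v + w) = bit_sign v * bit_sign w"
  using bit_exhaust[of v] bit_exhaust[of w] by (auto simp: bit_sign_def)

lemma bit_sign_sum: "finite J \<Longrightarrow> bit_sign (\<Sum>j\<in>J. y j) = (\<Prod>j\<in>J. bit_sign (y j))"
  by (induction rule: finite_induct) (auto simp: bit_sign_add, simp add: bit_sign_def)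

text \<open>Orthogonality of characters: the sum is the expansion of the product of the factors
  \<open>bit_sign (y j) + 1\<close>, each of which is 2 or 0.\<close>

lemma sum_characters:
  assumes "finite J"
  shows "(\<Sum>\<xi>\<in>Pow J. bit_sign (\<Sum>j\<in>\<xi>. y j)) = (if \<forall>j\<in>J. y j = 0 then 2 ^ card J else 0)"
proof -
  have "(\<Sum>\<xi>\<in>Pow J. bit_sign (\<Sum>j\<in>\<xi>. y j)) = (\<Sum>\<xi>\<in>Pow J. (\<Prod>j\<in>\<xi>. bit_sign (y j)) * (\<Prod>j\<in>J - \<xi>. 1))"
    by (intro sum.cong) (auto simp: bit_sign_sum finite_subset[OF _ assms])
  also have "\<dots> = (\<Prod>j\<in>J. bit_sign (y j) + 1)" using prod_add[OF assms, of "\<lambda>j. bit_sign (y j)" "\<lambda>_. 1"] by simp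
  also have "\<dots> = (if \<forall>j\<in>J. y j = 0 then 2 ^ card J else 0)"
    using assms by (auto simp: bit_sign_def intro!: prod_zero)
  finally show ?thesis .
qed

text \<open>The coordinate space on \<open>J\<close>, kept inside one function type so that passing
  to a quotient or to a basis only changes the index set.\<close>

definition supp_space :: "'i set \<Rightarrow> ('i \<Rightarrow> 'b::zero) set" where
  "supp_space J = {x. \<forall>i. i \<notin> J \<longrightarrow> x i = 0}"

text \<open>Fourier inversion at \<open>x\<close>: the trivial character contributes 1, and by
  \<open>bal\<close> every other one contributes at most \<open>2 * \<eta>\<close>.\<close>

lemma wt_le_of_balanced:
  fixes \<psi> :: "'a \<Rightarrow> 'i \<Rightarrow> bit"
  assumes A: "finite A" "A \<noteq> {}" and J: "finite J" and \<psi>: "\<psi> ` A \<subseteq> supp_space J"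
    and x: "x \<in> supp_space J" and "\<eta> \<ge> 0"
    and bal: "\<And>\<xi> v. \<xi> \<subseteq> J \<Longrightarrow> \<xi> \<noteq> {} \<Longrightarrow> wt A (\<lambda>a. \<Sum>j\<in>\<xi>. \<psi> a j) v \<le> 1 / 2 + \<eta>"
  shows "wt A \<psi> x \<le> 1 / 2 ^ card J + 2 * \<eta>"
proof -
  let ?l = "\<lambda>\<xi> y. \<Sum>j\<in>\<xi>. y j :: bit"
  have A0: "real (card A) > 0" using A by (simp add: card_gt_0_iff)
  \<comment> \<open>The shift is by \<open>x\<close> instead of \<open>- x\<close> because every
    element is its own inverse.\<close>
  have eq: "(\<forall>j\<in>J. (\<psi> a + x) j = 0) \<longleftrightarrow> \<psi> a = x" if "a \<in> A" for a
  proof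
    assume *: "\<forall>j\<in>J. (\<psi> a + x) j = 0"
    have "\<psi> a j = x j" for j
    proof (cases "j \<in> J")
      case True
      then show ?thesis using * bit_exhaust[of "\<psi> a j"] bit_exhaust[of "x j"] by force
    next
      case False
      then show ?thesis using \<psi> x that by (auto simp: supp_space_def)
    qed
    then show "\<psi> a = x" by auto
  next
    assume "\<psi> a = x"
    then show "\<forall>j\<in>J. (\<psi> a + x) j = 0" by (metis add_self_bit plus_fun_apply)
  qed
  have sgn: "(\<Sum>a\<in>A. bit_sign (?l \<xi> (\<psi> a + x))) = card A * (2 * wt A (\<lambda>a. ?l \<xi> (\<psi> a)) (?l \<xi> x) - 1)" for \<xi>
  proof -
    let ?S = "{a\<in>A. ?l \<xi> (\<psi> a) = ?l \<xi> x}"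
    have "bit_sign (?l \<xi> (\<psi> a + x)) = 2 * (if ?l \<xi> (\<psi> a) = ?l \<xi> x then 1 else 0) - 1" for a
      using bit_exhaust[of "?l \<xi> (\<psi> a)"] bit_exhaust[of "?l \<xi> x"]
      by (auto simp: sum.distrib bit_sign_def)
    then have "(\<Sum>a\<in>A. bit_sign (?l \<xi> (\<psi> a + x))) = 2 * card ?S - real (card A)"
      using A by (simp add: sum_subtractf sum.If_cases Int_def flip: sum_distrib_left)
    moreover have "card A * wt A (\<lambda>a. ?l \<xi> (\<psi> a)) (?l \<xi> x) = card ?S"
      using A0 by (simp add: wt_def)
    ultimately show ?thesis by (simp add: right_diff_distrib)
  qed
  have "2 ^ card J * (card A * wt A \<psi> x) = (\<Sum>a\<in>A. if \<psi> a = x then 2 ^ card J else 0)"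
    using A A0 by (simp add: wt_def sum.If_cases Int_def)
  also have "\<dots> = (\<Sum>a\<in>A. \<Sum>\<xi>\<in>Pow J. bit_sign (?l \<xi> (\<psi> a + x)))"
    using eq by (intro sum.cong) (auto simp only: sum_characters[OF J] if_True if_False)
  also have "\<dots> = (\<Sum>\<xi>\<in>Pow J. card A * (2 * wt A (\<lambda>a. ?l \<xi> (\<psi> a)) (?l \<xi> x) - 1))"
    by (subst sum.swap) (simp only: sgn)
  also have "\<dots> = card A * (\<Sum>\<xi>\<in>Pow J. 2 * wt A (\<lambda>a. ?l \<xi> (\<psi> a)) (?l \<xi> x) - 1)"
    by (simp only: sum_distrib_left)
  finally have "2 ^ card J * wt A \<psi> x = (\<Sum>\<xi>\<in>Pow J. 2 * wt A (\<lambda>a. ?l \<xi> (\<psi> a)) (?l \<xi> x) - 1)"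
    using A0 by simp
  also have "\<dots> \<le> (\<Sum>\<xi>\<in>Pow J. 2 * \<eta> + (if \<xi> = {} then 1 else 0))"
  proof (rule sum_mono)
    fix \<xi> assume "\<xi> \<in> Pow J"
    then show "2 * wt A (\<lambda>a. ?l \<xi> (\<psi> a)) (?l \<xi> x) - 1 \<le> 2 * \<eta> + (if \<xi> = {} then 1 else 0)"
      using bal[of \<xi> "?l \<xi> x"] wt_le_1[OF A, of "\<lambda>a. ?l \<xi> (\<psi> a)" "?l \<xi> x"] \<open>\<eta> \<ge> 0\<close>
      by (cases "\<xi> = {}") auto
  qed
  also have "\<dots> = 2 ^ card J * (2 * \<eta>) + 1"
    using J by (simp add: sum.distrib card_Pow)
  finally show ?thesis by (simp add: field_simps)
qed

section \<open>Quotients of binary spaces\<close>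

lemma coord_space_eq_supp_space: "coord_space D = supp_space {..<D}"
  by (auto simp: coord_space_def supp_space_def not_less)

lemma finite_supp_space:
  assumes "finite J"
  shows "finite (supp_space J :: ('i \<Rightarrow> bit) set)"
proof -
  have "finite (UNIV :: bit set)" unfolding UNIV_bit[of 0] by simp
  then have "finite {f :: 'i \<Rightarrow> bit. \<forall>x. (x \<in> J \<longrightarrow> f x \<in> UNIV) \<and> (x \<notin> J \<longrightarrow> f x = 0)}"
    using assms by (intro finite_set_of_finite_funs)
  then show ?thesis by (simp add: supp_space_def)
qed

lemma supp_space_add: "x \<in> supp_space J \<Longrightarrow> y \<in> supp_space J \<Longrightarrow> x + y \<in> supp_space J"
  for x y :: "'i \<Rightarrow> 'b::monoid_add"
  by (simp add: supp_space_def)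

lemma add_self_bit_fun: "x + x = (0 :: 'i \<Rightarrow> bit)"
  by (simp add: fun_eq_iff add_self_bit)

lemma add_self_cancel_bit_fun: "x + (x + y) = (y :: 'i \<Rightarrow> bit)"
  by (simp add: add_self_bit_fun flip: add.assoc)

lemma uminus_bit_fun: "- x = (x :: 'i \<Rightarrow> bit)"
  by (metis add_self_bit_fun minus_unique)

text \<open>Coordinates are eliminated one at a time, by induction on \<open>card H\<close>. Each
  lost coordinate is paid for by halving \<open>H\<close>, so the dimension drops by at most the
  binary logarithm of \<open>card H\<close>.\<close>

lemma quotient_map_exists:
  fixes H :: "('i \<Rightarrow> bit) set"
  assumes "finite J" "finite H" "0 \<in> H" "\<And>x y. x \<in> H \<Longrightarrow> y \<in> H \<Longrightarrow> x + y \<in> H"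
    and "H \<subseteq> supp_space J"
  shows "\<exists>J' (\<rho> :: ('i \<Rightarrow> bit) \<Rightarrow> 'i \<Rightarrow> bit). J' \<subseteq> J \<and> Modules.additive \<rho> \<and> \<rho> ` supp_space J = supp_space J' \<and>
     (\<forall>h\<in>H. \<rho> h = 0) \<and> 2 ^ card J \<le> card H * 2 ^ card J'"
  using assms
proof (induction "card H" arbitrary: H J rule: less_induct)
  case less
  show ?case
  proof (cases "H = {0}")
    case True
    then have "J \<subseteq> J \<and> Modules.additive id \<and> id ` supp_space J = (supp_space J :: ('i \<Rightarrow> bit) set) \<and>
        (\<forall>h\<in>H. id h = 0) \<and> 2 ^ card J \<le> card H * 2 ^ card J"
      by (simp add: Modules.additive_def)
    then show ?thesis by blast
  next
    case False
    then obtain h where h: "h \<in> H" "h \<noteq> 0" using less.prems(3) by auto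
    then obtain i where i: "h i = 1" by (auto simp: fun_eq_iff)
    then have iJ: "i \<in> J" using h less.prems(5) by (force simp: supp_space_def)
    \<comment> \<open>Projection along \<open>h\<close>: it kills \<open>h\<close>, clears
      coordinate \<open>i\<close>, and fixes every \<open>x\<close> with
      \<open>x i = 0\<close>.\<close>
    define \<sigma> where "\<sigma> x = (\<lambda>j. x j + x i * h j)" for x :: "'i \<Rightarrow> bit"
    define H' where "H' = {x\<in>H. x i = 0}"
    let ?J = "J - {i}"
    have \<sigma>_add: "\<sigma> (x + y) = \<sigma> x + \<sigma> y" for x y
      by (simp add: \<sigma>_def fun_eq_iff algebra_simps)
    have \<sigma>_H: "\<sigma> x \<in> H'" if "x \<in> H" for x
    proof -
      have "\<sigma> x = (if x i = 0 then x else x + h)" by (auto simp: \<sigma>_def fun_eq_iff)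
      moreover have "(x + h) i = 0" if "x i \<noteq> 0" using that i by (auto simp: add_self_bit)
      ultimately show ?thesis using that less.prems(4) h by (simp add: H'_def)
    qed
    have \<sigma>_id: "\<sigma> x = x" if "x i = 0" for x
      using that by (simp add: \<sigma>_def)
    have \<sigma>_img: "\<sigma> ` supp_space J = supp_space ?J"
    proof
      have "h \<in> supp_space J" using h less.prems(5) by auto
      then show "\<sigma> ` supp_space J \<subseteq> supp_space ?J"
        using i by (auto simp: \<sigma>_def supp_space_def add_self_bit)
      have "x \<in> \<sigma> ` supp_space J" if "x \<in> supp_space ?J" for x
        using that \<sigma>_id[of x] by (intro image_eqI[of _ _ x]) (auto simp: supp_space_def)
      then show "supp_space ?J \<subseteq> \<sigma> ` supp_space J" by blast
    qed
    have fH': "finite H'" using less.prems by (simp add: H'_def)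
    \<comment> \<open>\<open>H'\<close> and its translate by \<open>h\<close> differ in coordinate
      \<open>i\<close>, so they are disjoint inside \<open>H\<close>; this is the halving.\<close>
    have "card (H' \<union> (+) h ` H') \<le> card H"
      using less.prems h by (intro card_mono) (auto simp: H'_def)
    moreover have "H' \<inter> (+) h ` H' = {}" using i by (auto simp: H'_def)
    ultimately have card: "2 * card H' \<le> card H"
      using fH' by (simp add: card_Un_disjoint card_translate)
    have "card H' > 0" using fH' less.prems(3) by (auto simp: card_gt_0_iff H'_def)
    then have "card H' < card H" using card by simp
    moreover have "H' \<subseteq> supp_space ?J"
      using less.prems(5) by (force simp: H'_def supp_space_def)
    moreover have "finite ?J" "0 \<in> H'" using less.prems by (simp_all add: H'_def)
    moreover have "x + y \<in> H'" if "x \<in> H'" "y \<in> H'" for x y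
      using that less.prems(4) by (simp add: H'_def)
    ultimately obtain J' and \<rho> :: "('i \<Rightarrow> bit) \<Rightarrow> 'i \<Rightarrow> bit" where J': "J' \<subseteq> ?J"
      "Modules.additive \<rho>" "\<rho> ` supp_space ?J = supp_space J'"
      "\<forall>h\<in>H'. \<rho> h = 0" "2 ^ card ?J \<le> card H' * 2 ^ card J'"
      using less.hyps[of H' ?J] fH' by blast
    have "2 ^ card J = 2 * 2 ^ card ?J"
      using iJ less.prems(1) by (metis card.remove power_Suc)
    also have "\<dots> \<le> (2 * card H') * 2 ^ card J'" using J'(5) by simp
    also have "\<dots> \<le> card H * 2 ^ card J'" using card by (rule mult_le_mono1)
    finally have "2 ^ card J \<le> card H * 2 ^ card J'" .
    moreover have "Modules.additive (\<rho> \<circ> \<sigma>)"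
      using additive.add[OF J'(2)] \<sigma>_add by (simp add: Modules.additive_def)
    moreover have "(\<rho> \<circ> \<sigma>) ` supp_space J = supp_space J'"
      using \<sigma>_img J'(3) by (simp flip: image_image add: image_comp[symmetric])
    moreover have "J' \<subseteq> J" "\<forall>h\<in>H. (\<rho> \<circ> \<sigma>) h = 0" using J'(1,4) \<sigma>_H by auto
    ultimately show ?thesis by blast
  qed
qed

lemma wt_comp_ge:
  assumes "finite A" "finite Y" "\<And>y. y \<in> Y \<Longrightarrow> \<rho> y = z"
  shows "(\<Sum>y\<in>Y. wt A \<psi> y) \<le> wt A (\<rho> \<circ> \<psi>) z"
proof -
  have "(\<Sum>y\<in>Y. card {a\<in>A. \<psi> a = y}) = card (\<Union>y\<in>Y. {a\<in>A. \<psi> a = y})"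
    using assms by (intro card_UN_disjoint[symmetric]) auto
  also have "\<dots> \<le> card {a\<in>A. \<rho> (\<psi> a) = z}"
    using assms by (intro card_mono) auto
  finally have "real (\<Sum>y\<in>Y. card {a\<in>A. \<psi> a = y}) \<le> card {a\<in>A. \<rho> (\<psi> a) = z}"
    by (rule of_nat_mono)
  then show ?thesis
    by (simp add: wt_def flip: sum_divide_distrib) (simp add: divide_right_mono)
qed

text \<open>The constant becomes a parameter because \<open>\<tau>\<close> and the constants after
  it are chosen in terms of it.\<close>

definition pfr_with :: "real \<Rightarrow> bool" where
  "pfr_with c \<longleftrightarrow> (\<forall>(D::nat) (K::real) (A :: (nat \<Rightarrow> bit) set).
     A \<subseteq> coord_space D \<longrightarrow> A \<noteq> {} \<longrightarrow> doubling A \<le> K \<longrightarrow>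
     (\<exists>H \<C>. seq.subspace H \<and> H \<subseteq> coord_space D \<and> card H \<le> card A \<and>
        \<C> \<subseteq> {x +o H | x. x \<in> coord_space D} \<and> finite \<C> \<and>
        real (card \<C>) \<le> exp (c * ln (2 * K)) \<and> A \<subseteq> \<Union>\<C>))"

lemma PFR_F2_iff_pfr_with: "PFR_F2 \<longleftrightarrow> (\<exists>c>0. pfr_with c)"
  unfolding PFR_F2_def pfr_with_def ..

lemma sum_cover_le:
  fixes w :: "'a \<Rightarrow> real"
  assumes "finite S" "finite \<C>" "S \<subseteq> \<Union>\<C>" "\<And>y. 0 \<le> w y"
  shows "(\<Sum>y\<in>S. w y) \<le> (\<Sum>V\<in>\<C>. \<Sum>y\<in>S \<inter> V. w y)"
proof -
  have "(\<Sum>y\<in>S. w y) \<le> (\<Sum>y\<in>S. \<Sum>V\<in>\<C>. if y \<in> V then w y else 0)"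
  proof (rule sum_mono)
    fix y assume "y \<in> S"
    then obtain V where "V \<in> \<C>" "y \<in> V" using assms(3) by auto
    then show "w y \<le> (\<Sum>V\<in>\<C>. if y \<in> V then w y else 0)"
      using member_le_sum[of V \<C> "\<lambda>V. if y \<in> V then w y else 0"] assms(2,4) by simp
  qed
  also have "\<dots> = (\<Sum>V\<in>\<C>. \<Sum>y\<in>S. if y \<in> V then w y else 0)" by (rule sum.swap)
  also have "\<dots> = (\<Sum>V\<in>\<C>. \<Sum>y\<in>S \<inter> V. w y)"
    using assms(1) by (simp add: sum.inter_restrict)
  finally show ?thesis .
qed

text \<open>Pigeonhole: some coset of the cover carries at least the average share of the weight of
  \<open>S\<close>.\<close>

lemma pfr_heavy_coset:
  fixes S :: "(nat \<Rightarrow> bit) set" and w :: "(nat \<Rightarrow> bit) \<Rightarrow> real"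
  assumes pfr: "pfr_with c" and J: "finite J" and S: "S \<subseteq> supp_space J" "S \<noteq> {}"
    and K: "doubling S \<le> K" and w: "\<And>y. 0 \<le> w y" and pos: "(\<Sum>y\<in>S. w y) > 0"
  shows "\<exists>H x. 0 \<in> H \<and> (\<forall>u\<in>H. \<forall>v\<in>H. u + v \<in> H) \<and> H \<subseteq> supp_space J \<and> card H \<le> card S \<and>
     (\<Sum>y\<in>S. w y) \<le> exp (c * ln (2 * K)) * (\<Sum>y\<in>x +o H. w y)"
proof -
  obtain D where "J \<subseteq> {..<D}" using J unfolding finite_nat_set_iff_bounded by blast
  then have "S \<subseteq> coord_space D"
    using S by (force simp: coord_space_eq_supp_space supp_space_def)
  then obtain H \<C> where H: "seq.subspace H" "H \<subseteq> coord_space D" "card H \<le> card S"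
    and C: "\<C> \<subseteq> {x +o H | x. x \<in> coord_space D}" "finite \<C>"
      "real (card \<C>) \<le> exp (c * ln (2 * K))" "S \<subseteq> \<Union>\<C>"
    using pfr[unfolded pfr_with_def, rule_format, of S D K] S K by auto
  have finS: "finite S" using S J finite_supp_space finite_subset by blast
  have finH: "finite H"
    using H(2) finite_supp_space finite_subset by (auto simp: coord_space_eq_supp_space)
  have Hadd: "u + v \<in> H" if "u \<in> H" "v \<in> H" for u v
    using seq.subspace_add[OF H(1)] that by blast
  have H0: "0 \<in> H" using seq.subspace_0[OF H(1)] .
  define m where "m U = (\<Sum>y\<in>S \<inter> U. w y)" for U
  have m0: "m U \<ge> 0" for U unfolding m_def by (intro sum_nonneg w)
  have "\<C> \<noteq> {}" using C(4) S by auto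
  then obtain U where U: "U \<in> \<C>" "\<And>V. V \<in> \<C> \<Longrightarrow> m V \<le> m U"
    using ex_is_arg_min_if_finite[OF C(2), of "\<lambda>U. - m U"] by (auto simp: is_arg_min_linorder)
  have "(\<Sum>y\<in>S. w y) \<le> (\<Sum>V\<in>\<C>. m V)"
    unfolding m_def by (rule sum_cover_le) (use finS C w in auto)
  also have "\<dots> \<le> card \<C> * m U" using U(2) sum_bounded_above[of \<C> m "m U"] by simp
  also have "\<dots> \<le> exp (c * ln (2 * K)) * m U" using C(3) m0 by (intro mult_right_mono)
  finally have le: "(\<Sum>y\<in>S. w y) \<le> exp (c * ln (2 * K)) * m U" .
  then have "m U \<noteq> 0" using pos by auto
  \<comment> \<open>The coset is recentred at a point of \<open>S\<close>, since \<open>x'\<close>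
    need not lie in \<open>supp_space J\<close>. Differences of points of \<open>S\<close> do lie
    there, so \<open>H\<close> can be cut down to \<open>H'\<close> without losing a point of
    \<open>S \<inter> U\<close>.\<close>
  then obtain x where x: "x \<in> S" "x \<in> U" unfolding m_def by (metis IntE sum.neutral)
  obtain x' where x': "U = x' +o H" using U(1) C(1) by auto
  define H' where "H' = H \<inter> supp_space J"
  have "S \<inter> U \<subseteq> x +o H'"
  proof
    fix y assume y: "y \<in> S \<inter> U"
    obtain u v where uv: "u \<in> H" "v \<in> H" "x = x' + u" "y = x' + v"
      using x(2) y x' by (auto simp: elt_set_plus_def)
    have "y = x + (u + v)"
      using uv(3,4) by (simp add: add.assoc add_self_cancel_bit_fun)
    moreover have "u + v = x + y"
      using uv(3,4) by (simp only: ac_simps add_self_bit_fun add_0_right add_0_left)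
    then have "u + v \<in> H'"
      using supp_space_add[of x J y] x(1) y S(1) Hadd[OF uv(1,2)] by (auto simp: H'_def)
    ultimately show "y \<in> x +o H'" by (simp only: set_plus_intro2)
  qed
  moreover have "finite (x +o H')"
  proof -
    have "x +o H' = (+) x ` H'" by (auto simp: elt_set_plus_def)
    then show ?thesis using finH by (simp add: H'_def)
  qed
  ultimately have "m U \<le> (\<Sum>y\<in>x +o H'. w y)"
    unfolding m_def by (intro sum_mono2 w)
  then have "(\<Sum>y\<in>S. w y) \<le> exp (c * ln (2 * K)) * (\<Sum>y\<in>x +o H'. w y)"
    using le by (smt (verit) exp_ge_zero mult_left_mono)
  moreover have "card H' \<le> card S"
    using H(3) card_mono[OF finH, of H'] by (auto simp: H'_def)
  ultimately show ?thesis
    using H0 Hadd by (intro exI[of _ H'] exI[of _ x]) (auto simp: H'_def supp_space_def)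
qed

section \<open>Concentration on a coset\<close>

text \<open>Splitting off \<open>w y powr (1 - \<theta>)\<close> bounds mass by a Renyi sum. It
  serves for full sums, with \<open>L\<close> the largest weight, and for tails below a
  threshold.\<close>

lemma sum_small_le:
  fixes w :: "'a \<Rightarrow> real"
  assumes "0 < \<theta>" "\<theta> < 1" "\<And>y. y \<in> Y \<Longrightarrow> 0 \<le> w y \<and> w y \<le> L" "(\<Sum>y\<in>Y. w y powr \<theta>) \<le> M"
    and "0 \<le> L"
  shows "(\<Sum>y\<in>Y. w y) \<le> L powr (1 - \<theta>) * M"
proof -
  have "(\<Sum>y\<in>Y. w y) \<le> (\<Sum>y\<in>Y. L powr (1 - \<theta>) * w y powr \<theta>)"
  proof (rule sum_mono)
    fix y assume "y \<in> Y"
    then have y: "0 \<le> w y" "w y \<le> L" using assms(3) by auto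
    have "w y = w y powr (1 - \<theta>) * w y powr \<theta>"
      using y by (simp flip: powr_add)
    also have "\<dots> \<le> L powr (1 - \<theta>) * w y powr \<theta>"
      using y assms by (intro mult_right_mono powr_mono2) auto
    finally show "w y \<le> L powr (1 - \<theta>) * w y powr \<theta>" .
  qed
  also have "\<dots> = L powr (1 - \<theta>) * (\<Sum>y\<in>Y. w y powr \<theta>)" by (simp add: sum_distrib_left)
  also have "\<dots> \<le> L powr (1 - \<theta>) * M" using assms by (intro mult_left_mono) auto
  finally show ?thesis .
qed

text \<open>The Renyi entropy of order \<open>\<theta>\<close> of one weight is bounded by the min-entropy of the other.\<close>

lemma sum_wt_powr_le:
  assumes reg: "regular_pair \<theta> A B" and \<psi>: "Modules.additive \<psi>" and "finite Y" and q: "0 < wt B \<psi> y"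
  shows "(\<Sum>x\<in>Y. wt A \<psi> x powr \<theta>) \<le> wt B \<psi> y powr - \<theta>"
proof -
  have "(\<Sum>z\<in>(+) y ` Y. (wt A \<psi> (z - y) * wt B \<psi> y) powr \<theta>) \<le> 1"
    using assms(3) by (intro fibre_sum_le_1[OF reg \<psi>]) auto
  then have "(\<Sum>x\<in>Y. wt A \<psi> x powr \<theta>) * wt B \<psi> y powr \<theta> \<le> 1"
    by (simp add: sum.reindex powr_mult sum_distrib_right)
  then show ?thesis using q by (simp add: powr_minus divide_simps)
qed

text \<open>The slack conditions on exponents needed below; at \<open>\<theta> = 1 / 2\<close> all of them hold strictly.\<close>

definition admissible :: "real \<Rightarrow> real \<Rightarrow> bool" where
  "admissible \<tau> \<theta> \<longleftrightarrow> 1 / 2 < \<theta> \<and> \<theta> < 1 \<and>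
     \<tau> / 4 \<le> (1 + \<tau>) * (1 - \<theta>) - \<theta> \<and>
     \<tau> / 4 \<le> (1 + \<tau>) * (1 - \<theta>) - \<theta>\<^sup>2 / (1 - \<theta>) \<and>
     - 3 * \<tau> \<le> 1 + (1 - \<theta>) / \<theta> - 4 * \<theta> * (1 + \<tau>)"

text \<open>Points of weight above \<open>p powr (1 + \<tau>)\<close> carry at least half the mass
  on both sides. The fibre inequality bounds the sumset of these two level sets, so \<open>S\<close>
  has doubling at most \<open>4 * p powr (- 3 * \<tau>)\<close>, and the covering statement for
  \<open>S\<close> loses only a small power of \<open>p\<close>.\<close>

lemma heavy_coset_of_regular_pair:
  fixes \<psi> :: "'a::ab_group_add \<Rightarrow> nat \<Rightarrow> bit"
  assumes reg: "regular_pair \<theta> A B" and \<psi>: "Modules.additive \<psi>"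
    and J: "finite J" "\<psi> ` A \<subseteq> supp_space J"
    and pfr: "pfr_with c" and \<tau>: "0 < \<tau>" "\<tau> \<le> 1 / 40" "40 * c * \<tau> \<le> 1" "0 < c"
    and adm: "admissible \<tau> \<theta>"
    and max: "\<And>x. wt A \<psi> x \<le> p" and x0: "wt A \<psi> x0 = p"
    and p: "0 < p" "p < 1" "p powr (\<tau> / 4) \<le> 1 / 8"
  shows "\<exists>H x. 0 \<in> H \<and> (\<forall>u\<in>H. \<forall>v\<in>H. u + v \<in> H) \<and> H \<subseteq> supp_space J \<and>
     real (card H) \<le> p powr -2 \<and> p powr (1 / 4) \<le> (\<Sum>y\<in>x +o H. wt A \<psi> y)"
proof -
  note AB = regular_pairD[OF reg]
  have \<theta>: "1 / 2 < \<theta>" "\<theta> < 1"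
    and e1: "\<tau> / 4 \<le> (1 + \<tau>) * (1 - \<theta>) - \<theta>"
    and e2: "\<tau> / 4 \<le> (1 + \<tau>) * (1 - \<theta>) - \<theta>\<^sup>2 / (1 - \<theta>)"
    and e3: "- 3 * \<tau> \<le> 1 + (1 - \<theta>) / \<theta> - 4 * \<theta> * (1 + \<tau>)"
    using adm by (auto simp: admissible_def)
  have pw: "p powr s \<le> p powr t" if "t \<le> s" for s t
    using p that by (intro powr_mono') auto
  let ?a = "wt A \<psi>" and ?b = "wt B \<psi>"
  define YA where "YA = \<psi> ` A"
  define YB where "YB = \<psi> ` B"
  have Y: "finite YA" "finite YB" "YA \<noteq> {}" "YB \<noteq> {}" using AB by (auto simp: YA_def YB_def)
  obtain y0 where y0: "y0 \<in> YB" "\<And>y. y \<in> YB \<Longrightarrow> ?b y \<le> ?b y0"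
    using ex_is_arg_min_if_finite[OF Y(2,4), of "\<lambda>y. - ?b y"] by (auto simp: is_arg_min_linorder)
  define q where "q = ?b y0"
  have q0: "q > 0" using wt_pos[OF AB(2), of y0 \<psi>] y0(1) by (simp add: q_def YB_def)
  have sa: "(\<Sum>x\<in>Y. ?a x powr \<theta>) \<le> q powr - \<theta>" if "finite Y" for Y
    using sum_wt_powr_le[OF reg \<psi> that, of y0] q0 by (simp add: q_def)
  have sb: "(\<Sum>x\<in>Y. ?b x powr \<theta>) \<le> p powr - \<theta>" if "finite Y" for Y
    using sum_wt_powr_le[OF regular_pair_commute[OF reg] \<psi> that, of x0] p x0 by simp
  have sumA: "(\<Sum>x\<in>YA. ?a x) = 1" using sum_wt[OF AB(1,3) Y(1)] by (simp add: YA_def)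
  have sumB: "(\<Sum>x\<in>YB. ?b x) = 1" using sum_wt[OF AB(2,4) Y(2)] by (simp add: YB_def)
  \<comment> \<open>The total mass 1 is bounded by each Renyi sum in turn, which ties
    \<open>q\<close> to \<open>p\<close> from both sides; at \<open>\<theta> = 1 / 2\<close> the two
    bounds would force \<open>p = q\<close>.\<close>
  have "1 \<le> p powr (1 - \<theta>) * q powr - \<theta>"
    using sum_small_le[of \<theta> YA ?a p "q powr - \<theta>"] \<theta> max p sa[OF Y(1)] sumA by simp
  then have qp: "q powr \<theta> \<le> p powr (1 - \<theta>)" using q0 by (simp add: powr_minus divide_simps)
  have "1 \<le> q powr (1 - \<theta>) * p powr - \<theta>"
    using sum_small_le[of \<theta> YB ?b q "p powr - \<theta>"] \<theta> y0(2) q0 sb[OF Y(2)] sumB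
    by (simp add: q_def)
  then have "p powr \<theta> \<le> q powr (1 - \<theta>)" using p by (simp add: powr_minus divide_simps)
  then have "(p powr \<theta>) powr (\<theta> / (1 - \<theta>)) \<le> (q powr (1 - \<theta>)) powr (\<theta> / (1 - \<theta>))"
    using \<theta> by (intro powr_mono2) auto
  then have "p powr (\<theta>\<^sup>2 / (1 - \<theta>)) \<le> q powr \<theta>"
    using \<theta> by (simp add: powr_powr power2_eq_square)
  then have qm: "q powr - \<theta> \<le> p powr - (\<theta>\<^sup>2 / (1 - \<theta>))"
    using p q0 by (simp add: powr_minus le_imp_inverse_le)
  have "(q powr \<theta>) powr (1 / \<theta>) \<le> (p powr (1 - \<theta>)) powr (1 / \<theta>)"
    using \<theta> qp by (intro powr_mono2) auto
  then have qle: "q \<le> p powr ((1 - \<theta>) / \<theta>)" using \<theta> q0 by (simp add: powr_powr)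

  define \<mu> where "\<mu> = p powr (1 + \<tau>)"
  have \<mu>0: "\<mu> > 0" using p by (simp add: \<mu>_def)
  define S where "S = {x\<in>YA. \<mu> < ?a x}"
  define T where "T = {y\<in>YB. \<mu> < ?b y}"
  have fin: "finite S" "finite T" using Y by (auto simp: S_def T_def)
  have p4: "p powr (\<tau> / 4) \<le> 1 / 2" using p by simp
  have "(\<Sum>x\<in>YA - S. ?a x) \<le> \<mu> powr (1 - \<theta>) * p powr - (\<theta>\<^sup>2 / (1 - \<theta>))"
    using sa[of "YA - S"] Y(1) qm \<theta> \<mu>0 by (intro sum_small_le) (auto simp: S_def)
  also have "\<dots> = p powr ((1 + \<tau>) * (1 - \<theta>) - \<theta>\<^sup>2 / (1 - \<theta>))"
    using p by (simp add: \<mu>_def powr_powr flip: powr_add)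
  also have "\<dots> \<le> p powr (\<tau> / 4)" by (rule pw) (rule e2)
  finally have "(\<Sum>x\<in>S. ?a x) \<ge> 1 / 2"
    using p4 sumA sum.subset_diff[of S YA ?a] Y(1) by (simp add: S_def)
  note Smass = this
  have "(\<Sum>x\<in>YB - T. ?b x) \<le> \<mu> powr (1 - \<theta>) * p powr - \<theta>"
    using sb[of "YB - T"] Y(2) \<theta> \<mu>0 by (intro sum_small_le) (auto simp: T_def)
  also have "\<dots> = p powr ((1 + \<tau>) * (1 - \<theta>) - \<theta>)"
    using p by (simp add: \<mu>_def powr_powr flip: powr_add)
  also have "\<dots> \<le> p powr (\<tau> / 4)" by (rule pw) (rule e1)
  finally have Tmass: "(\<Sum>x\<in>T. ?b x) \<ge> 1 / 2"
    using p4 sumB sum.subset_diff[of T YB ?b] Y(2) by (simp add: T_def)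
  have Sp: "1 / 2 \<le> card S * p"
    using Smass sum_bounded_above[of S ?a p] max by simp
  have Tq: "1 / 2 \<le> card T * q"
    using Tmass sum_bounded_above[of T ?b q] y0(2) by (simp add: T_def q_def)
  have S0: "card S > 0" "S \<noteq> {}" using Sp by (auto intro: Nat.gr0I)
  have T0: "card T > 0" using Tq by (auto intro: Nat.gr0I)

  \<comment> \<open>One representation for each element of \<open>S + T\<close> is fed into the
    fibre inequality; every summand is at least
    \<open>(\<mu> * \<mu>) powr \<theta>\<close>.\<close>
  have "\<forall>z\<in>S + T. \<exists>x y. x \<in> S \<and> y \<in> T \<and> x + y = z" by (auto simp: set_plus_def)
  then obtain f g where fg: "\<And>z. z \<in> S + T \<Longrightarrow> f z \<in> S \<and> g z \<in> T \<and> f z + g z = z" by metis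
  have "card (S + T) * (\<mu> * \<mu>) powr \<theta> \<le> (\<Sum>z\<in>S + T. (?a (f z) * ?b (g z)) powr \<theta>)"
  proof (rule sum_bounded_below[THEN order_trans[rotated]])
    fix z assume "z \<in> S + T"
    then have "\<mu> \<le> ?a (f z)" "\<mu> \<le> ?b (g z)" using fg by (auto simp: S_def T_def intro: less_imp_le)
    then show "(\<mu> * \<mu>) powr \<theta> \<le> (?a (f z) * ?b (g z)) powr \<theta>"
      using \<mu>0 \<theta> by (intro powr_mono2 mult_mono) auto
  qed simp
  also have "\<dots> \<le> 1" using fin fg by (intro fibre_sum_le_1[OF reg \<psi>] finite_sumset) auto
  also have "(\<mu> * \<mu>) powr \<theta> = p powr (2 * \<theta> * (1 + \<tau>))"
    using p by (simp add: \<mu>_def powr_powr algebra_simps flip: powr_add)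
  finally have ST: "real (card (S + T)) \<le> p powr - (2 * \<theta> * (1 + \<tau>))"
    using p by (simp add: powr_minus divide_simps)
  \<comment> \<open>In characteristic two the triangle inequality involves sumsets only.\<close>
  have "uminus ` T = T" by (simp add: uminus_bit_fun)
  then have "card T * card (S + S) \<le> card (S + T) * card (T + S)"
    using ruzsa_triangle[of T S S] fin by simp
  then have "real (card T) * card (S + S) \<le> real (card (S + T)) * card (S + T)"
    by (metis add.commute of_nat_le_iff of_nat_mult)
  also have "\<dots> \<le> p powr - (2 * \<theta> * (1 + \<tau>)) * p powr - (2 * \<theta> * (1 + \<tau>))"
    using ST by (intro mult_mono) auto
  also have "\<dots> = p powr - (4 * \<theta> * (1 + \<tau>))" using p by (simp add: mult.assoc flip: powr_add)
  finally have SS: "real (card T) * card (S + S) \<le> p powr - (4 * \<theta> * (1 + \<tau>))" .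
  \<comment> \<open>The two mass bounds cancel the factor \<open>card T\<close> at the price of
    \<open>q\<close>, and bring in the \<open>card S\<close> of the doubling constant; they also
    produce the factor 4.\<close>
  have "1 * 1 \<le> (2 * (card T * q)) * (2 * (card S * p))"
    using Sp Tq by (intro mult_mono) auto
  then have "real (card (S + S)) * 1 \<le> card (S + S) * ((2 * (card T * q)) * (2 * (card S * p)))"
    by (intro mult_left_mono) auto
  also have "\<dots> = 4 * (real (card T) * card (S + S)) * q * p * card S" by simp
  also have "\<dots> \<le> 4 * p powr - (4 * \<theta> * (1 + \<tau>)) * p powr ((1 - \<theta>) / \<theta>) * p powr 1 * card S"
    using SS qle q0 p by (intro mult_mono) auto
  also have "\<dots> = 4 * p powr (1 + (1 - \<theta>) / \<theta> - 4 * \<theta> * (1 + \<tau>)) * card S"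
    by (simp only: diff_conv_add_uminus powr_add ac_simps)
  also have "\<dots> \<le> 4 * p powr (- 3 * \<tau>) * card S"
    by (intro mult_right_mono mult_left_mono pw e3) auto
  finally have "doubling S \<le> 4 * p powr (- 3 * \<tau>)"
    using S0 by (simp add: doubling_def pos_divide_le_eq)
  moreover have "S \<subseteq> supp_space J" using J(2) by (auto simp: S_def YA_def)
  moreover have "0 < (\<Sum>y\<in>S. ?a y)" using Smass by linarith
  ultimately obtain H x where H: "0 \<in> H" "\<forall>u\<in>H. \<forall>v\<in>H. u + v \<in> H" "H \<subseteq> supp_space J" "card H \<le> card S"
    and mass: "(\<Sum>y\<in>S. ?a y) \<le> exp (c * ln (2 * (4 * p powr (- 3 * \<tau>)))) * (\<Sum>y\<in>x +o H. ?a y)"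
    using pfr_heavy_coset[OF pfr J(1), of S "4 * p powr (- 3 * \<tau>)" ?a] S0(2) wt_nonneg[of A \<psi>] by blast
  have "card S * \<mu> \<le> 1"
    using sum_bounded_below[of S \<mu> ?a] sum_wt_le[OF AB(1,3) fin(1), of \<psi>] by (auto simp: S_def)
  then have "real (card S) \<le> p powr - (1 + \<tau>)"
    using p unfolding \<mu>_def powr_minus_divide by (simp add: pos_le_divide_eq)
  also have "\<dots> \<le> p powr -2" using \<tau> by (intro pw) simp
  finally have cardH: "real (card H) \<le> p powr -2" using H(4) by linarith
  \<comment> \<open>Smallness of \<open>p\<close> absorbs the constant \<open>8 = 2 * 4\<close> into
    \<open>p powr - \<tau>\<close>. The covering number is then at most
    \<open>p powr (- 4 * \<tau> * c)\<close>, and \<open>40 * c * \<tau> \<le> 1\<close> makes this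
    at most \<open>p powr - (1 / 10)\<close>.\<close>
  have "p powr (\<tau> / 4) * p powr - (\<tau> / 4) = 1" using p by (simp flip: powr_add)
  then have "8 \<le> p powr - (\<tau> / 4)"
    using p mult_right_mono[OF p(3), of "p powr - (\<tau> / 4)"] by simp
  also have "\<dots> \<le> p powr - \<tau>" using \<tau> by (intro pw) simp
  finally have "8 * p powr (- 3 * \<tau>) \<le> p powr - \<tau> * p powr (- 3 * \<tau>)" by (intro mult_right_mono) auto
  also have "\<dots> = p powr (- 4 * \<tau>)" by (simp flip: powr_add)
  finally have "(8 * p powr (- 3 * \<tau>)) powr c \<le> (p powr (- 4 * \<tau>)) powr c"
    using \<tau> p by (intro powr_mono2) auto
  also have "\<dots> = p powr (- 4 * \<tau> * c)" by (simp add: powr_powr)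
  also have "\<dots> \<le> p powr - (1 / 10)" using \<tau>(3) by (intro pw) (simp add: mult_ac)
  finally have "exp (c * ln (2 * (4 * p powr (- 3 * \<tau>)))) \<le> p powr - (1 / 10)"
    using p by (simp add: powr_def)
  moreover have "0 \<le> (\<Sum>y\<in>x +o H. ?a y)" by (intro sum_nonneg) simp
  ultimately have "1 / 2 \<le> p powr - (1 / 10) * (\<Sum>y\<in>x +o H. ?a y)"
    using Smass mass mult_right_mono by (meson order_trans)
  then have m: "1 / 2 * p powr (1 / 10) \<le> (\<Sum>y\<in>x +o H. ?a y)"
    using p by (simp add: powr_minus field_simps)
  \<comment> \<open>The surplus \<open>p powr (3 / 20)\<close> absorbs the factor
    \<open>1 / 2\<close>.\<close>
  have "p powr (1 / 4) = p powr (3 / 20) * p powr (1 / 10)" using p by (simp flip: powr_add)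
  also have "\<dots> \<le> 1 / 2 * p powr (1 / 10)"
    using pw[of "\<tau> / 4" "3 / 20"] \<tau> p4 by (intro mult_right_mono) auto
  finally have "p powr (1 / 4) \<le> (\<Sum>y\<in>x +o H. ?a y)" using m by linarith
  then show ?thesis using H cardH by blast
qed

section \<open>Bounding the rank of a regular pair\<close>

text \<open>For \<open>b < 1 / 2 + \<eta>\<close> monotonicity reduces to hypothesis
  \<open>2\<close>. Otherwise the worst case is \<open>a = b = 1 - t\<close>: Bernoulli's inequality
  bounds the loss \<open>1 - b powr (2 * \<theta>)\<close> by \<open>2 * \<theta> * t\<close>, and
  hypothesis \<open>1\<close> makes the gain \<open>b powr \<theta> * t powr \<theta>\<close>
  larger.\<close>

lemma balancingI:
  assumes \<theta>: "1 / 2 < \<theta>" "\<theta> < 1" and \<eta>: "0 < \<eta>" "\<eta> < 1 / 2"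
    and 1: "2 * \<theta> * (1 / 2 - \<eta>) powr (1 - \<theta>) < (1 / 2 + \<eta>) powr \<theta>"
    and 2: "1 < (1 / 2 + \<eta>) powr \<theta> * ((1 / 2) powr \<theta> + (1 / 2 - \<eta>) powr \<theta>)"
  shows "balancing \<theta> \<eta>"
  unfolding balancing_def
proof (intro allI impI)
  fix a b :: real
  assume b: "1 / 2 \<le> b" "b < 1" and ab: "b \<le> a" "a \<le> 1" "1 / 2 + \<eta> < a"
  show "1 < a powr \<theta> * (b powr \<theta> + (1 - b) powr \<theta>)"
  proof (cases "b < 1 / 2 + \<eta>")
    case True
    note 2
    also have "(1 / 2 + \<eta>) powr \<theta> * ((1 / 2) powr \<theta> + (1 / 2 - \<eta>) powr \<theta>)
        \<le> a powr \<theta> * (b powr \<theta> + (1 - b) powr \<theta>)"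
      using True b ab \<theta> \<eta> by (intro mult_mono add_mono powr_mono2) auto
    finally show ?thesis .
  next
    case False
    define t where "t = 1 - b"
    have t: "0 < t" "t \<le> 1 / 2 - \<eta>" "b = 1 - t" using b False by (auto simp: t_def)
    have b0: "0 < b" using b by simp
    have "ln (1 / b) \<le> 1 / b - 1" using b0 by (intro ln_le_minus_one) simp
    then have lnb: "b - 1 \<le> b * ln b" using b0 by (simp add: ln_div field_simps)
    have "1 - 2 * \<theta> * t = b + (2 * \<theta> - 1) * (b - 1)" by (simp add: t algebra_simps)
    also have "\<dots> \<le> b + (2 * \<theta> - 1) * (b * ln b)"
      using lnb \<theta> by (intro add_left_mono mult_left_mono) auto
    also have "\<dots> = b * (1 + (2 * \<theta> - 1) * ln b)" by (simp add: algebra_simps)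
    also have "\<dots> \<le> b * exp ((2 * \<theta> - 1) * ln b)" using b0 by (intro mult_left_mono exp_ge_add_one_self) auto
    also have "\<dots> = b powr 1 * b powr (2 * \<theta> - 1)" using b0 by (simp add: powr_def)
    also have "\<dots> = b powr \<theta> * b powr \<theta>" by (simp only: powr_add[symmetric]) simp
    finally have bern: "1 - 2 * \<theta> * t \<le> b powr \<theta> * b powr \<theta>" .
    have "2 * \<theta> * t powr (1 - \<theta>) \<le> 2 * \<theta> * (1 / 2 - \<eta>) powr (1 - \<theta>)"
      using t \<theta> by (intro mult_left_mono powr_mono2) auto
    also have "\<dots> < (1 / 2 + \<eta>) powr \<theta>" by (rule 1)
    also have "\<dots> \<le> b powr \<theta>" using False \<theta> \<eta> by (intro powr_mono2) auto
    finally have "2 * \<theta> * t powr (1 - \<theta>) * t powr \<theta> < b powr \<theta> * t powr \<theta>"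
      using t by (intro mult_strict_right_mono) auto
    also have "2 * \<theta> * t powr (1 - \<theta>) * t powr \<theta> = 2 * \<theta> * t"
      using t by (simp add: mult.assoc flip: powr_add)
    finally have "1 < b powr \<theta> * (b powr \<theta> + t powr \<theta>)" using bern by (simp add: distrib_left)
    also have "\<dots> \<le> a powr \<theta> * (b powr \<theta> + t powr \<theta>)"
      using ab b0 \<theta> by (intro mult_right_mono powr_mono2 add_nonneg_nonneg) auto
    finally show ?thesis by (simp add: t_def)
  qed
qed

text \<open>Both hypotheses of \<open>balancingI\<close> are strict at
  \<open>\<theta> = 1 / 2\<close> and persist by continuity. In the second, the gain is at least
  \<open>\<eta> / 3\<close> and the loss at most \<open>2 * \<eta> * \<eta>\<close>, whence the
  condition \<open>\<eta> < 1 / 6\<close>.\<close>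

lemma eventually_balancing:
  assumes \<eta>: "0 < \<eta>" "\<eta> < 1 / 6"
  shows "\<forall>\<^sub>F \<theta> in at_right (1 / 2). balancing \<theta> \<eta>"
proof -
  let ?f1 = "\<lambda>\<theta>. (1 / 2 + \<eta>) powr \<theta> - 2 * \<theta> * (1 / 2 - \<eta>) powr (1 - \<theta>)"
  let ?f2 = "\<lambda>\<theta>. (1 / 2 + \<eta>) powr \<theta> * ((1 / 2) powr \<theta> + (1 / 2 - \<eta>) powr \<theta>)"
  have "(?f1 \<longlongrightarrow> ?f1 (1 / 2)) (at_right (1 / 2))" using \<eta> by (intro tendsto_intros) auto
  moreover have "?f1 (1 / 2) > 0" using \<eta> by (simp add: powr_half_sqrt)
  ultimately have ev1: "\<forall>\<^sub>F \<theta> in at_right (1 / 2). ?f1 \<theta> > 0" by (rule order_tendstoD)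
  have aux: "1 < s + t" if "(1 + 2 * \<eta> / 3) / 2 \<le> s" "(1 - 4 * \<eta>\<^sup>2) / 2 \<le> t" "\<eta>\<^sup>2 < \<eta> / 6"
    for s t :: real
    using that by (simp add: field_simps)
  have "(1 + 2 * \<eta> / 3) / 2 \<le> sqrt ((1 / 2 + \<eta>) * (1 / 2))"
    using \<eta> by (intro real_le_rsqrt) (simp add: power2_eq_square field_simps)
  moreover have "(1 - 4 * \<eta>\<^sup>2) / 2 \<le> sqrt ((1 / 2 + \<eta>) * (1 / 2 - \<eta>))"
  proof (rule real_le_rsqrt)
    have "\<eta>\<^sup>2 < 1 / 4" using \<eta> power_strict_mono[of \<eta> "1 / 2" 2] by (simp add: power2_eq_square)
    then have "(1 - 4 * \<eta>\<^sup>2) * (1 - 4 * \<eta>\<^sup>2) \<le> 1 * (1 - 4 * \<eta>\<^sup>2)" by (intro mult_right_mono) auto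
    then show "((1 - 4 * \<eta>\<^sup>2) / 2)\<^sup>2 \<le> (1 / 2 + \<eta>) * (1 / 2 - \<eta>)"
      by (simp add: power2_eq_square field_simps)
  qed
  moreover have "\<eta>\<^sup>2 < \<eta> / 6"
    using mult_strict_left_mono[OF \<eta>(2,1)] by (simp add: power2_eq_square)
  ultimately have "1 < sqrt ((1 / 2 + \<eta>) * (1 / 2)) + sqrt ((1 / 2 + \<eta>) * (1 / 2 - \<eta>))"
    by (rule aux)
  moreover have "?f2 (1 / 2) = sqrt ((1 / 2 + \<eta>) * (1 / 2)) + sqrt ((1 / 2 + \<eta>) * (1 / 2 - \<eta>))"
    using \<eta> by (simp only: powr_half_sqrt distrib_left real_sqrt_mult)
  ultimately have "?f2 (1 / 2) > 1"
    by (simp only:)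
  moreover have "(?f2 \<longlongrightarrow> ?f2 (1 / 2)) (at_right (1 / 2))" using \<eta> by (intro tendsto_intros) auto
  ultimately have ev2: "\<forall>\<^sub>F \<theta> in at_right (1 / 2). ?f2 \<theta> > 1" by (intro order_tendstoD)
  have ev3: "\<forall>\<^sub>F \<theta> in at_right (1 / 2). 1 / 2 < \<theta> \<and> \<theta> < (1::real)"
    unfolding eventually_at_right_field by (intro exI[of _ 1]) auto
  show ?thesis
    using ev1 ev2 ev3 by eventually_elim (intro balancingI, use \<eta> in auto)
qed

text \<open>At \<open>\<theta> = 1 / 2\<close> the three expressions equal
  \<open>\<tau> / 2\<close>, \<open>\<tau> / 2\<close> and \<open>- 2 * \<tau>\<close>, so
  continuity leaves room to the right.\<close>

lemma eventually_admissible: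
  assumes "0 < \<tau>"
  shows "\<forall>\<^sub>F \<theta> in at_right (1 / 2). admissible \<tau> \<theta>"
proof -
  let ?f1 = "\<lambda>\<theta>. (1 + \<tau>) * (1 - \<theta>) - \<theta>"
  let ?f2 = "\<lambda>\<theta>. (1 + \<tau>) * (1 - \<theta>) - \<theta>\<^sup>2 / (1 - \<theta>)"
  let ?f3 = "\<lambda>\<theta>. 1 + (1 - \<theta>) / \<theta> - 4 * \<theta> * (1 + \<tau>)"
  have "(?f1 \<longlongrightarrow> ?f1 (1 / 2)) (at_right (1 / 2))" by (intro tendsto_intros)
  then have ev1: "\<forall>\<^sub>F \<theta> in at_right (1 / 2). ?f1 \<theta> > \<tau> / 4"
    by (rule order_tendstoD) (use assms in \<open>simp add: field_simps\<close>)
  have "(?f2 \<longlongrightarrow> ?f2 (1 / 2)) (at_right (1 / 2))" by (intro tendsto_intros) auto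
  then have ev2: "\<forall>\<^sub>F \<theta> in at_right (1 / 2). ?f2 \<theta> > \<tau> / 4"
    by (rule order_tendstoD) (use assms in \<open>simp add: power2_eq_square field_simps\<close>)
  have "(?f3 \<longlongrightarrow> ?f3 (1 / 2)) (at_right (1 / 2))" by (intro tendsto_intros) auto
  then have ev3: "\<forall>\<^sub>F \<theta> in at_right (1 / 2). ?f3 \<theta> > - 3 * \<tau>"
    by (rule order_tendstoD) (use assms in \<open>simp add: field_simps\<close>)
  have ev4: "\<forall>\<^sub>F \<theta> in at_right (1 / 2). 1 / 2 < \<theta> \<and> \<theta> < (1::real)"
    unfolding eventually_at_right_field by (intro exI[of _ 1]) auto
  show ?thesis
    using ev1 ev2 ev3 ev4 by eventually_elim (simp add: admissible_def)
qed

text \<open>Order of choice: \<open>\<tau>\<close> from \<open>c\<close>, \<open>p0\<close> from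
  \<open>\<tau>\<close>, then \<open>\<eta>\<close> and \<open>k0\<close>, each using up half of
  \<open>p0\<close>, and finally \<open>\<theta>\<close> close to \<open>1 / 2\<close>.\<close>

lemma constants_exist:
  assumes "0 < c"
  shows "\<exists>\<tau> p0 \<eta> \<theta> k0. 0 < \<tau> \<and> \<tau> \<le> 1 / 40 \<and> 40 * c * \<tau> \<le> 1 \<and> 0 < p0 \<and> p0 < 1 \<and>
    p0 powr (\<tau> / 4) \<le> 1 / 8 \<and> 0 \<le> \<eta> \<and> 1 / 2 ^ k0 + 2 * \<eta> \<le> p0 \<and> balancing \<theta> \<eta> \<and> admissible \<tau> \<theta>"
proof -
  define \<tau> where "\<tau> = 1 / (40 * (c + 1))"
  have \<tau>: "0 < \<tau>" "\<tau> \<le> 1 / 40" "40 * c * \<tau> \<le> 1"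
    using assms by (auto simp: \<tau>_def divide_simps)
  define p0 :: real where "p0 = (1 / 8) powr (4 / \<tau>)"
  have p0: "0 < p0" by (simp add: p0_def)
  have "p0 < (1 / 8) powr 0" unfolding p0_def using \<tau> by (intro powr_less_mono') auto
  then have p01: "p0 < 1" by simp
  have p08: "p0 powr (\<tau> / 4) \<le> 1 / 8" using \<tau> by (simp add: p0_def powr_powr)
  define \<eta> where "\<eta> = min (p0 / 4) (1 / 12)"
  have \<eta>: "0 < \<eta>" "\<eta> < 1 / 6" "\<eta> \<le> p0 / 4" using p0 by (auto simp: \<eta>_def)
  obtain k0 where "(1 / 2 :: real) ^ k0 < p0 / 2" using real_arch_pow_inv[of "p0 / 2" "1 / 2"] p0 by auto
  then have "1 / 2 ^ k0 + 2 * \<eta> \<le> p0" using \<eta> by (simp add: power_divide)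
  moreover obtain \<theta> where "balancing \<theta> \<eta>" "admissible \<tau> \<theta>"
    using eventually_happens[OF eventually_conj[OF eventually_balancing[OF \<eta>(1,2)] eventually_admissible[OF \<tau>(1)]]]
    by auto
  ultimately show ?thesis using \<tau> p0 p01 p08 \<eta>(1) by (meson less_imp_le)
qed

text \<open>The potential \<open>2 ^ card J * p ^ 4\<close>, with \<open>p\<close> the largest
  weight in the quotient on \<open>J\<close>, does not fall when a heavy subgroup is factored out.
  This is possible while \<open>k0 \<le> card J\<close>: by \<open>gen\<close> no nontrivial
  character is constant on both sets, so all are balanced and \<open>p \<le> p0\<close>.\<close>

lemma rank_le_of_regular_pair:
  fixes \<phi> :: "'a::ab_group_add \<Rightarrow> nat \<Rightarrow> bit"
  assumes c: "0 < c" "pfr_with c" and \<tau>: "0 < \<tau>" "\<tau> \<le> 1 / 40" "40 * c * \<tau> \<le> 1"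
    and p0: "0 < p0" "p0 < 1" "p0 powr (\<tau> / 4) \<le> 1 / 8"
    and \<eta>: "0 \<le> \<eta>" "1 / 2 ^ k0 + 2 * \<eta> \<le> p0" and bal: "balancing \<theta> \<eta>" and adm: "admissible \<tau> \<theta>"
    and reg: "regular_pair \<theta> A B" and \<phi>: "Modules.additive \<phi>"
    and I: "finite I" "\<phi> ` A \<subseteq> supp_space I"
    and gen: "\<And>\<chi> :: (nat \<Rightarrow> bit) \<Rightarrow> bit. \<And>v w. Modules.additive \<chi> \<Longrightarrow> wt A (\<chi> \<circ> \<phi>) v = 1 \<Longrightarrow>
      wt B (\<chi> \<circ> \<phi>) w = 1 \<Longrightarrow> \<forall>x\<in>supp_space I. \<chi> x = 0"
    and x0: "0 < wt A \<phi> x0"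
  shows "2 ^ card I * wt A \<phi> x0 ^ 4 \<le> 2 ^ k0"
proof -
  note AB = regular_pairD[OF reg]
  \<comment> \<open>The iteration is run as a minimal choice: among the quotients that keep the
    initial potential, one with the fewest coordinates is taken.\<close>
  define P where "P J \<longleftrightarrow> J \<subseteq> I \<and> (\<exists>(\<rho> :: (nat \<Rightarrow> bit) \<Rightarrow> nat \<Rightarrow> bit) x. Modules.additive \<rho> \<and>
    \<rho> ` supp_space I = supp_space J \<and> 0 < wt A (\<rho> \<circ> \<phi>) x \<and>
    2 ^ card I * wt A \<phi> x0 ^ 4 \<le> 2 ^ card J * wt A (\<rho> \<circ> \<phi>) x ^ 4)" for J
  have "P I"
    unfolding P_def using x0 by (intro conjI exI[of _ id] exI[of _ x0]) (auto simp: Modules.additive_def)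
  then obtain J where PJ: "P J" and Jmin: "\<And>J'. P J' \<Longrightarrow> card J \<le> card J'"
    using ex_has_least_nat[of P I card] by blast
  then obtain \<rho> :: "(nat \<Rightarrow> bit) \<Rightarrow> nat \<Rightarrow> bit" and x1 where JI: "J \<subseteq> I" and \<rho>: "Modules.additive \<rho>"
    and img: "\<rho> ` supp_space I = supp_space J" and w1: "0 < wt A (\<rho> \<circ> \<phi>) x1"
    and pot1: "2 ^ card I * wt A \<phi> x0 ^ 4 \<le> 2 ^ card J * wt A (\<rho> \<circ> \<phi>) x1 ^ 4"
    unfolding P_def by blast
  have finJ: "finite J" using JI I(1) finite_subset by blast
  let ?\<psi> = "\<rho> \<circ> \<phi>"
  have \<psi>: "Modules.additive ?\<psi>"
    using additive.add[OF \<rho>] additive.add[OF \<phi>] by (simp add: Modules.additive_def)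
  have \<psi>J: "?\<psi> ` A \<subseteq> supp_space J" using I(2) img by (simp add: image_comp[symmetric]) blast
  have "finite (?\<psi> ` A)" "?\<psi> ` A \<noteq> {}" using AB by auto
  then obtain x where x: "x \<in> ?\<psi> ` A" "\<And>y. y \<in> ?\<psi> ` A \<Longrightarrow> wt A ?\<psi> y \<le> wt A ?\<psi> x"
    using ex_is_arg_min_if_finite[of "?\<psi> ` A" "\<lambda>y. - wt A ?\<psi> y"] by (auto simp: is_arg_min_linorder)
  define p where "p = wt A ?\<psi> x"
  have wt0: "wt A ?\<psi> y = 0" if "y \<notin> ?\<psi> ` A" for y
  proof -
    have "{a\<in>A. ?\<psi> a = y} = {}" using that by auto
    then show ?thesis unfolding wt_def by (simp only: card.empty of_nat_0 div_0)
  qed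
  have max: "wt A ?\<psi> y \<le> p" for y
    using x(2)[of y] wt0[of y] by (cases "y \<in> ?\<psi> ` A") (auto simp: p_def)
  have p: "0 < p" "p \<le> 1" using max[of x1] w1 wt_le_1[OF AB(1,3)] by (auto simp: p_def)
  have "wt A ?\<psi> x1 ^ 4 \<le> p ^ 4" using max by (intro power_mono) auto
  then have pot: "2 ^ card I * wt A \<phi> x0 ^ 4 \<le> 2 ^ card J * p ^ 4"
    using pot1 by (smt (verit) mult_left_mono zero_le_power)
  have "card J < k0"
  proof (rule ccontr)
    assume k: "\<not> card J < k0"
    have "p \<le> 1 / 2 ^ card J + 2 * \<eta>"
      unfolding p_def
    proof (rule wt_le_of_balanced[OF AB(1,3) finJ \<psi>J _ \<eta>(1)])
      show "x \<in> supp_space J" using x(1) \<psi>J by blast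
      fix \<xi> v assume \<xi>: "\<xi> \<subseteq> J" "\<xi> \<noteq> {}"
      define \<chi> where "\<chi> y = (\<Sum>j\<in>\<xi>. \<rho> y j)" for y
      have \<chi>: "Modules.additive \<chi>"
        by (simp add: Modules.additive_def \<chi>_def additive.add[OF \<rho>] sum.distrib)
      have l: "(\<lambda>a. \<Sum>j\<in>\<xi>. ?\<psi> a j) = \<chi> \<circ> \<phi>" by (simp add: \<chi>_def fun_eq_iff)
      have \<chi>\<phi>: "Modules.additive (\<chi> \<circ> \<phi>)"
        using additive.add[OF \<chi>] additive.add[OF \<phi>] by (simp add: Modules.additive_def)
      obtain j where j: "j \<in> \<xi>" using \<xi> by auto
      \<comment> \<open>A preimage of the unit vector \<open>e\<close> is a point of
        \<open>supp_space I\<close> where \<open>\<chi>\<close> is 1, so \<open>gen\<close> applies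
        in the contrapositive.\<close>
      define e where "e i = (if i = j then 1 else 0 :: bit)" for i
      have "e \<in> supp_space J" using j \<xi> by (auto simp: e_def supp_space_def)
      then obtain y where y: "y \<in> supp_space I" "\<rho> y = e" using img by (metis imageE)
      have "\<chi> y = 1" using y(2) j finite_subset[OF \<xi>(1) finJ] by (simp add: \<chi>_def e_def)
      then have "wt A (\<chi> \<circ> \<phi>) v \<noteq> 1 \<or> wt B (\<chi> \<circ> \<phi>) w \<noteq> 1" for v w
        using gen[OF \<chi>, of v w] y(1) by auto
      then show "wt A (\<lambda>a. \<Sum>j\<in>\<xi>. ?\<psi> a j) v \<le> 1 / 2 + \<eta>"
        unfolding l by (intro wt_balanced[OF reg \<chi>\<phi> bal \<eta>(1)])
    qed
    also have "\<dots> \<le> 1 / 2 ^ k0 + 2 * \<eta>" using k by (intro add_right_mono divide_left_mono power_increasing) auto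
    finally have pp0: "p \<le> p0" using \<eta>(2) by linarith
    have "p powr (\<tau> / 4) \<le> p0 powr (\<tau> / 4)" using pp0 p \<tau> by (intro powr_mono2) auto
    then have p8: "p powr (\<tau> / 4) \<le> 1 / 8" using p0 by simp
    have p1: "p < 1" using pp0 p0 by simp
    obtain H z where H: "0 \<in> H" "\<forall>u\<in>H. \<forall>v\<in>H. u + v \<in> H" "H \<subseteq> supp_space J" "real (card H) \<le> p powr -2"
      and mass: "p powr (1 / 4) \<le> (\<Sum>y\<in>z +o H. wt A ?\<psi> y)"
      using heavy_coset_of_regular_pair[OF reg \<psi> finJ \<psi>J c(2) \<tau> c(1) adm max p_def[symmetric] p(1) p1 p8]
      by blast
    have finH: "finite H" using H(3) finite_supp_space[OF finJ] finite_subset by blast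
    obtain J' and \<sigma> :: "(nat \<Rightarrow> bit) \<Rightarrow> nat \<Rightarrow> bit" where J': "J' \<subseteq> J" "Modules.additive \<sigma>"
      "\<sigma> ` supp_space J = supp_space J'" "\<forall>h\<in>H. \<sigma> h = 0" "2 ^ card J \<le> card H * 2 ^ card J'"
      using quotient_map_exists[OF finJ finH H(1) _ H(3)] H(2) by blast
    have coset: "z +o H = (+) z ` H" by (auto simp: elt_set_plus_def)
    \<comment> \<open>A trivial \<open>H\<close> would give a point of weight at least
      \<open>p powr (1 / 4)\<close>, which exceeds \<open>p\<close>. Nontriviality makes the
      quotient strictly smaller.\<close>
    have "H \<noteq> {0}"
    proof
      assume "H = {0}"
      then have "z +o H = {z}" by (simp add: elt_set_plus_def)
      then have "p powr (1 / 4) \<le> p" using mass max[of z] by simp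
      moreover have "p powr 1 < p powr (1 / 4)" using p p1 by (intro powr_less_mono') auto
      ultimately show False using p by simp
    qed
    then obtain h where "h \<in> H" "h \<noteq> 0" using H(1) by blast
    then have "\<not> inj_on \<sigma> (supp_space J)" using H(1,3) J'(4) by (metis inj_onD subsetD)
    then have "J' \<noteq> J" using J'(3) eq_card_imp_inj_on[OF finite_supp_space[OF finJ], of \<sigma>] by auto
    then have less: "card J' < card J" using J'(1) finJ by (simp add: psubset_card_mono psubset_eq)
    have comp: "\<sigma> \<circ> (\<rho> \<circ> \<phi>) = (\<sigma> \<circ> \<rho>) \<circ> \<phi>" by (simp add: comp_assoc)
    have "(\<Sum>y\<in>z +o H. wt A ?\<psi> y) \<le> wt A (\<sigma> \<circ> ?\<psi>) (\<sigma> z)"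
      using AB(1) finH J'(4) by (intro wt_comp_ge) (auto simp: coset additive.add[OF J'(2)])
    then have mass': "p powr (1 / 4) \<le> wt A ((\<sigma> \<circ> \<rho>) \<circ> \<phi>) (\<sigma> z)" using mass by (simp add: comp)
    have "P J'"
      unfolding P_def
    proof (intro conjI exI[of _ "\<sigma> \<circ> \<rho>"] exI[of _ "\<sigma> z"])
      show "J' \<subseteq> I" using J'(1) JI by simp
      show "Modules.additive (\<sigma> \<circ> \<rho>)"
        using additive.add[OF J'(2)] additive.add[OF \<rho>] by (simp add: Modules.additive_def)
      show "(\<sigma> \<circ> \<rho>) ` supp_space I = supp_space J'" using img J'(3) by (metis image_comp)
      show "0 < wt A ((\<sigma> \<circ> \<rho>) \<circ> \<phi>) (\<sigma> z)" using mass' p(1) by (smt (verit) powr_gt_zero)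
      \<comment> \<open>The size of the space drops by a factor of at most \<open>p powr -2\<close>,
        while the fourth power of the weight rises from \<open>p ^ 4\<close> to at least
        \<open>p\<close>.\<close>
      have "real (2 ^ card J) \<le> real (card H * 2 ^ card J')" using J'(5) by (rule of_nat_mono)
      then have "2 ^ card J \<le> real (card H) * 2 ^ card J'" by simp
      also have "\<dots> \<le> p powr -2 * 2 ^ card J'" using H(4) by (intro mult_right_mono) auto
      finally have "2 ^ card J * p ^ 4 \<le> p powr -2 * 2 ^ card J' * p ^ 4"
        using p by (intro mult_right_mono) auto
      also have "\<dots> = 2 ^ card J' * p ^ 2"
        using p by (simp add: powr_minus power_numeral_reduce divide_simps)
      also have "\<dots> \<le> 2 ^ card J' * p ^ 1" using p by (intro mult_left_mono power_decreasing) auto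
      also have "p ^ 1 = (p powr (1 / 4)) ^ 4" using p by (simp add: powr_power)
      also have "2 ^ card J' * (p powr (1 / 4)) ^ 4 \<le> 2 ^ card J' * wt A ((\<sigma> \<circ> \<rho>) \<circ> \<phi>) (\<sigma> z) ^ 4"
        using mass' by (intro mult_left_mono power_mono) auto
      finally show "2 ^ card I * wt A \<phi> x0 ^ 4 \<le> 2 ^ card J' * wt A ((\<sigma> \<circ> \<rho>) \<circ> \<phi>) (\<sigma> z) ^ 4"
        using pot by linarith
    qed
    then show False using Jmin[of J'] less by simp
  qed
  then have "(2::real) ^ card J * p ^ 4 \<le> 2 ^ k0 * 1"
    using p by (intro mult_mono power_increasing power_le_one) auto
  then show ?thesis using pot by linarith
qed

section \<open>Integer lattices and reduction modulo 2\<close>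

definition int_comb :: "('i \<Rightarrow> nat \<Rightarrow> int) \<Rightarrow> 'i set \<Rightarrow> ('i \<Rightarrow> int) \<Rightarrow> nat \<Rightarrow> int" where
  "int_comb g I c = (\<lambda>k. \<Sum>i\<in>I. c i * g i k)"

definition int_span :: "('i \<Rightarrow> nat \<Rightarrow> int) \<Rightarrow> 'i set \<Rightarrow> (nat \<Rightarrow> int) set" where
  "int_span g I = range (int_comb g I)"

lemma additive_int_comb: "Modules.additive (int_comb g I)"
  by (simp add: Modules.additive_def int_comb_def fun_eq_iff algebra_simps sum.distrib)

lemma int_span_0: "0 \<in> int_span g I"
  unfolding int_span_def using additive.zero[OF additive_int_comb, of g I] by (metis rangeI)

lemma int_span_add: "x \<in> int_span g I \<Longrightarrow> y \<in> int_span g I \<Longrightarrow> x + y \<in> int_span g I"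
  unfolding int_span_def by (auto simp flip: additive.add[OF additive_int_comb])

lemma int_span_uminus: "x \<in> int_span g I \<Longrightarrow> - x \<in> int_span g I"
  unfolding int_span_def by (auto simp flip: additive.minus[OF additive_int_comb])

lemma int_span_base:
  assumes "finite I" "i \<in> I"
  shows "g i \<in> int_span g I"
proof -
  have "int_comb g I (\<lambda>j. if j = i then 1 else 0) k = (\<Sum>j\<in>I. if j = i then g j k else 0)" for k
    unfolding int_comb_def by (intro sum.cong) auto
  then have "int_comb g I (\<lambda>j. if j = i then 1 else 0) = g i" using assms by (simp add: fun_eq_iff)
  then show ?thesis unfolding int_span_def by (metis rangeI)
qed

lemma int_span_least:
  assumes "finite I" and 0: "0 \<in> M" and add: "\<And>x y. x \<in> M \<Longrightarrow> y \<in> M \<Longrightarrow> x + y \<in> M"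
    and um: "\<And>x. x \<in> M \<Longrightarrow> - x \<in> M" and base: "\<And>i. i \<in> I \<Longrightarrow> g i \<in> M"
  shows "int_span g I \<subseteq> M"
proof -
  have scale: "(\<lambda>k. n * x k) \<in> M" if "x \<in> M" for n x
  proof (induction n rule: int_induct[where k = 0])
    case base
    then show ?case using 0 by (simp add: zero_fun_def)
  next
    case (step1 n)
    have "(\<lambda>k. n * x k) + x \<in> M" using step1 that by (intro add)
    then show ?case by (simp add: plus_fun_def algebra_simps)
  next
    case (step2 n)
    have "(\<lambda>k. n * x k) + - x \<in> M" using step2 that by (intro add um)
    then show ?case by (simp add: plus_fun_def algebra_simps)
  qed
  have "int_comb g I c \<in> M" for c
    using assms(1) base
  proof (induction I rule: finite_induct)
    case empty
    then show ?case using 0 by (simp add: int_comb_def zero_fun_def)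
  next
    case (insert i I)
    then have "(\<lambda>k. c i * g i k) + int_comb g I c \<in> M" by (intro add scale) auto
    then show ?case using insert(1,2) by (simp add: int_comb_def plus_fun_def)
  qed
  then show ?thesis by (auto simp: int_span_def)
qed

lemma int_span_mono:
  assumes "finite I" "\<And>i. i \<in> I \<Longrightarrow> g i \<in> int_span h J"
  shows "int_span g I \<subseteq> int_span h J"
  using assms by (intro int_span_least int_span_0 int_span_add int_span_uminus)

text \<open>Euclid's algorithm on the coefficients of an integer relation removes one generator.\<close>

lemma int_span_remove_generator:
  assumes "finite I" "int_comb g I c = 0" "\<exists>i\<in>I. c i \<noteq> 0"
  shows "\<exists>g' i. i \<in> I \<and> int_span g' (I - {i}) = int_span g I"
  using assms(2,3)
proof (induction "\<Sum>i\<in>I. nat \<bar>c i\<bar>" arbitrary: c g rule: less_induct)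
  case less
  have "I \<noteq> {}" using less.prems by auto
  then obtain i where i: "i \<in> I" "\<And>j. j \<in> I \<Longrightarrow> \<bar>c j\<bar> \<le> \<bar>c i\<bar>"
    using ex_is_arg_min_if_finite[OF assms(1), of "\<lambda>i. - \<bar>c i\<bar>"] by (auto simp: is_arg_min_linorder)
  have ci: "c i \<noteq> 0" using i(2) less.prems(2) by fastforce
  show ?case
  proof (cases "\<exists>j\<in>I - {i}. c j \<noteq> 0")
    \<comment> \<open>Only one coefficient is nonzero, so the relation says that \<open>g i\<close>
      vanishes.\<close>
    case False
    have "c i * g i k = 0" for k
    proof -
      have "(\<Sum>j\<in>I. c j * g j k) = c i * g i k + (\<Sum>j\<in>I - {i}. c j * g j k)"
        using assms(1) i(1) by (rule sum.remove)
      also have "(\<Sum>j\<in>I - {i}. c j * g j k) = 0" using False by (intro sum.neutral) auto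
      finally show ?thesis using less.prems(1) by (simp add: int_comb_def fun_eq_iff)
    qed
    then have gi: "g i = 0" using ci by (simp add: fun_eq_iff)
    have "int_span g (I - {i}) = int_span g I"
    proof
      show "int_span g (I - {i}) \<subseteq> int_span g I"
        using assms(1) by (intro int_span_mono int_span_base) auto
      have "g j \<in> int_span g (I - {i})" if "j \<in> I" for j
        using that assms(1) gi int_span_0 by (cases "j = i") (auto intro: int_span_base)
      then show "int_span g I \<subseteq> int_span g (I - {i})" using assms(1) by (intro int_span_mono)
    qed
    then show ?thesis using i(1) by blast
  next
    case True
    then obtain j where j: "j \<in> I" "j \<noteq> i" "c j \<noteq> 0" by blast
    \<comment> \<open>This sign makes \<open>c i - s * c j\<close> smaller than \<open>c i\<close>
      in absolute value, as \<open>c i\<close> is the largest coefficient. The compensating change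
      of \<open>g j\<close> keeps the relation and the lattice.\<close>
    define s where "s = sgn (c i) * sgn (c j)"
    have s: "s = 1 \<or> s = - 1" using ci j(3) by (auto simp: s_def sgn_if)
    define c' where "c' = c(i := c i - s * c j)"
    define g' where "g' = g(j := (\<lambda>k. g j k + s * g i k))"
    have sg: "(\<lambda>k. s * x k) \<in> int_span h I" if "x \<in> int_span h I" for h x
      using s int_span_uminus[OF that] that by (auto simp: fun_Compl_def)
    have "\<bar>c i - s * c j\<bar> < \<bar>c i\<bar>"
      using i(2)[OF j(1)] ci j(3) by (auto simp: s_def sgn_if abs_if split: if_splits)
    then have "(\<Sum>m\<in>I. nat \<bar>c' m\<bar>) < (\<Sum>m\<in>I. nat \<bar>c m\<bar>)"
      using assms(1) i(1) by (intro sum_strict_mono_ex1) (auto simp: c'_def)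
    moreover have "int_comb g' I c' = 0"
    proof
      fix k
      have "(\<Sum>m\<in>I. c' m * g' m k) = (\<Sum>m\<in>I. c m * g m k
          + (if m = i then - (s * c j * g i k) else 0) + (if m = j then c j * (s * g i k) else 0))"
        using j(2) by (intro sum.cong) (auto simp: c'_def g'_def algebra_simps)
      also have "\<dots> = (\<Sum>m\<in>I. c m * g m k)"
        using assms(1) i(1) j(1) by (simp add: sum.distrib)
      finally show "int_comb g' I c' k = 0 k"
        using less.prems(1) by (simp add: int_comb_def fun_eq_iff)
    qed
    moreover have "\<exists>m\<in>I. c' m \<noteq> 0" using j by (intro bexI[of _ j]) (auto simp: c'_def)
    ultimately obtain h m where h: "m \<in> I" "int_span h (I - {m}) = int_span g' I"
      using less.hyps by blast
    have "int_span g' I = int_span g I"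
    proof
      have "g' m \<in> int_span g I" if "m \<in> I" for m
        using int_span_add[OF int_span_base[OF assms(1) j(1)] sg[OF int_span_base[OF assms(1) i(1)]], of g]
          int_span_base[OF assms(1) that, of g] by (auto simp: g'_def plus_fun_def)
      then show "int_span g' I \<subseteq> int_span g I" using assms(1) by (intro int_span_mono)
      have gi: "g i \<in> int_span g' I"
        using int_span_base[OF assms(1) i(1), of g'] j(2) by (simp add: g'_def)
      have "g' j + - (\<lambda>k. s * g i k) \<in> int_span g' I"
        using assms(1) j(1) gi by (intro int_span_add int_span_uminus sg int_span_base)
      moreover have "g' j + - (\<lambda>k. s * g i k) = g j" by (simp add: g'_def fun_eq_iff)
      ultimately have "g m \<in> int_span g' I" if "m \<in> I" for m
        using int_span_base[OF assms(1) that, of g'] by (cases "m = j") (auto simp: g'_def)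
      then show "int_span g I \<subseteq> int_span g' I" using assms(1) by (intro int_span_mono)
    qed
    then show ?thesis using h by metis
  qed
qed

text \<open>A relation in a generating family of least size would allow a generator to be removed.
  The basis vectors need not be among the \<open>s i\<close>; only their indices come from
  \<open>N\<close>.\<close>

lemma int_span_basis_exists:
  assumes "finite N"
  shows "\<exists>I g. I \<subseteq> N \<and> int_span g I = int_span s N \<and>
    (\<forall>c. int_comb g I c = 0 \<longrightarrow> (\<forall>i\<in>I. c i = 0))"
proof -
  define P where "P I \<longleftrightarrow> I \<subseteq> N \<and> (\<exists>g. int_span g I = int_span s N)" for I
  have "P N" by (auto simp: P_def)
  then obtain I where I: "P I" and min: "\<And>J. P J \<Longrightarrow> card I \<le> card J"
    using ex_has_least_nat[of P N card] by blast
  then obtain g where g: "I \<subseteq> N" "int_span g I = int_span s N" by (auto simp: P_def)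
  have fin: "finite I" using g(1) assms finite_subset by blast
  have "\<forall>i\<in>I. c i = 0" if rel: "int_comb g I c = 0" for c
  proof (rule ccontr)
    assume "\<not> ?thesis"
    then obtain g' i where gi: "i \<in> I" "int_span g' (I - {i}) = int_span g I"
      using int_span_remove_generator[OF fin rel] by blast
    then have "P (I - {i})" using g by (auto simp: P_def)
    then have "card I \<le> card (I - {i})" by (rule min)
    moreover have "card (I - {i}) < card I" using fin gi(1) by (rule card_Diff1_less)
    ultimately show False by simp
  qed
  then show ?thesis using g by blast
qed

text \<open>A minimiser of \<open>Q\<close> is regular. Comparison with \<open>(A, A)\<close> bounds
  the minimum from above and \<open>card (A' + B') ^ 2 \<ge> card A' * card B'\<close> from below;
  the surplus \<open>\<epsilon>\<close> in the exponent turns this into a lower bound for the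
  product \<open>r\<close> of the two densities.\<close>

lemma regular_pair_exists:
  fixes A :: "'a::ab_group_add set" and K \<epsilon> :: real
  assumes A: "finite A" "A \<noteq> {}" and K: "real (card (A + A)) \<le> K * card A" and \<epsilon>: "0 < \<epsilon>"
  shows "\<exists>A' B'. A' \<subseteq> A \<and> B' \<subseteq> A \<and> regular_pair (1 / 2 + \<epsilon>) A' B' \<and>
    K powr (- (1 / \<epsilon>)) * card A \<le> card A' \<and> K powr (- (1 / \<epsilon>)) * card A \<le> card B'"
proof -
  let ?\<theta> = "1 / 2 + \<epsilon>"
  define Q :: "'a set \<times> 'a set \<Rightarrow> real"
    where "Q = (\<lambda>(S, T). card (S + T) / (real (card S) * card T) powr ?\<theta>)"
  define P where "P = (Pow A - {{}}) \<times> (Pow A - {{}})"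
  have "finite P" "P \<noteq> {}" using A by (auto simp: P_def)
  then obtain z where z: "z \<in> P" "\<And>y. y \<in> P \<Longrightarrow> Q z \<le> Q y"
    using ex_is_arg_min_if_finite[of P Q] by (auto simp: is_arg_min_linorder)
  obtain A' B' where AB': "z = (A', B')" by force
  have sub: "A' \<subseteq> A" "B' \<subseteq> A" "A' \<noteq> {}" "B' \<noteq> {}" using z(1) by (auto simp: AB' P_def)
  have fin: "finite A'" "finite B'" using sub A finite_subset by auto
  have pos: "0 < real (card A')" "0 < real (card B')" "0 < real (card A)"
    using fin sub A by (auto simp: card_gt_0_iff)
  have reg: "regular_pair ?\<theta> A' B'"
    unfolding regular_pair_def
  proof (intro conjI allI impI fin sub)
    fix S T assume ST: "S \<subseteq> A'" "T \<subseteq> B'" "S \<noteq> {}" "T \<noteq> {}"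
    then have "finite S" "finite T" using fin finite_subset by auto
    then have st: "0 < real (card S)" "0 < real (card T)" using ST by (auto simp: card_gt_0_iff)
    have "Q (A', B') \<le> Q (S, T)" using z(2)[of "(S, T)"] ST sub by (auto simp: AB' P_def)
    then have "card (A' + B') / (real (card A') * card B') powr ?\<theta> * (real (card S) * card T) powr ?\<theta>
        \<le> card (S + T)"
      using st by (simp add: Q_def field_simps)
    also have "card (A' + B') / (real (card A') * card B') powr ?\<theta> * (real (card S) * card T) powr ?\<theta>
        = card (A' + B') * ((real (card S) * card T) / (real (card A') * card B')) powr ?\<theta>"
      using pos st by (simp add: powr_divide)
    finally show "card (A' + B') * (card S / card A' * (card T / card B')) powr ?\<theta> \<le> card (S + T)"
      by simp
  qed
  define X where "X = real (card A') * card B'"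
  define r where "r = X / (real (card A))\<^sup>2"
  have X0: "0 < X" using pos by (simp add: X_def)
  have r0: "0 < r" using X0 pos by (simp add: r_def)
  have "card A' \<le> card (A' + B')" "card B' \<le> card (A' + B')"
    using card_le_sumset[of A' B'] card_le_sumset[of B' A'] fin sub by (auto simp: add.commute)
  then have "X \<le> (real (card (A' + B')))\<^sup>2"
    unfolding X_def power2_eq_square by (intro mult_mono) auto
  then have "X powr (1 / 2) \<le> card (A' + B')"
    using X0 by (simp add: powr_half_sqrt real_le_lsqrt)
  then have "X powr (1 / 2) / X powr ?\<theta> \<le> Q (A', B')"
    by (simp add: Q_def X_def divide_right_mono)
  moreover have "X powr (1 / 2) / X powr ?\<theta> = X powr - \<epsilon>" by (simp flip: powr_diff)
  moreover have "Q (A', B') \<le> Q (A, A)" using z(2)[of "(A, A)"] A by (auto simp: AB' P_def)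
  moreover have "Q (A, A) \<le> K * card A / (real (card A) * card A) powr ?\<theta>"
    using K by (simp add: Q_def divide_right_mono)
  moreover have "K * card A / (real (card A) * card A) powr ?\<theta> = K * ((real (card A))\<^sup>2) powr - \<epsilon>"
  proof -
    have "(real (card A) * card A) powr ?\<theta> = card A * ((real (card A))\<^sup>2) powr \<epsilon>"
      using pos by (simp add: powr_add powr_half_sqrt power2_eq_square)
    then show ?thesis using pos by (simp add: powr_minus field_simps)
  qed
  ultimately have "X powr - \<epsilon> \<le> K * ((real (card A))\<^sup>2) powr - \<epsilon>" by linarith
  then have "X powr - \<epsilon> / ((real (card A))\<^sup>2) powr - \<epsilon> \<le> K"
    using pos by (simp add: pos_divide_le_eq)
  then have rK: "r powr - \<epsilon> \<le> K" using X0 pos by (simp add: r_def powr_divide)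
  have "K powr - (1 / \<epsilon>) \<le> (r powr - \<epsilon>) powr - (1 / \<epsilon>)"
    using rK r0 \<epsilon> by (intro powr_mono2') auto
  also have "\<dots> = r" using \<epsilon> r0 by (simp add: powr_powr)
  finally have Kr: "K powr - (1 / \<epsilon>) \<le> r" .
  have le: "real (card A') \<le> card A" "real (card B') \<le> card A" using sub A by (auto intro: card_mono)
  \<comment> \<open>Both densities are at most 1, so each is at least their product
    \<open>r\<close>.\<close>
  have "r * card A = card A' * (card B' / card A)" "r * card A = card B' * (card A' / card A)"
    using pos by (simp_all add: r_def X_def power2_eq_square)
  moreover have "card A' * (card B' / card A) \<le> card A' * 1" "card B' * (card A' / card A) \<le> card B' * 1"
    using le pos by (auto simp: pos_divide_le_eq)
  moreover have "K powr - (1 / \<epsilon>) * card A \<le> r * card A" using Kr by (intro mult_right_mono) auto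
  ultimately have "K powr - (1 / \<epsilon>) * card A \<le> card A'" "K powr - (1 / \<epsilon>) * card A \<le> card B'"
    by linarith+
  then show ?thesis using sub(1,2) reg by blast
qed

section \<open>Reduction modulo 2\<close>

definition mod2 :: "(nat \<Rightarrow> int) \<Rightarrow> nat \<Rightarrow> bit" where
  "mod2 x = (\<lambda>i. of_int (x i))"

lemma additive_mod2: "Modules.additive mod2"
  by (simp add: Modules.additive_def mod2_def fun_eq_iff)

lemma mod2_supp_space: "mod2 ` supp_space I = supp_space I"
proof
  show "mod2 ` supp_space I \<subseteq> supp_space I" by (auto simp: mod2_def supp_space_def)
  have "x \<in> mod2 ` supp_space I" if "x \<in> supp_space I" for x
  proof (rule image_eqI)
    show "x = mod2 (\<lambda>i. if x i = 0 then 0 else 1)" by (auto simp: mod2_def fun_eq_iff)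
    show "(\<lambda>i. if x i = 0 then 0 else 1) \<in> supp_space I" using that by (auto simp: supp_space_def)
  qed
  then show "supp_space I \<subseteq> mod2 ` supp_space I" by blast
qed

text \<open>The sets \<open>a + 2\<cdot>A\<close> are disjoint for \<open>a\<close> in different classes modulo 2.\<close>

lemma card_mod2_image_le:
  fixes K :: real
  assumes A: "finite A" "A \<noteq> {}" and K: "real (card (A + A)) \<le> K * card A"
  shows "real (card (mod2 ` A)) \<le> K ^ 4"
proof -
  have "\<forall>x\<in>mod2 ` A. \<exists>a. a \<in> A \<and> mod2 a = x" by auto
  then obtain r where r: "\<And>x. x \<in> mod2 ` A \<Longrightarrow> r x \<in> A \<and> mod2 (r x) = x"
    by metis
  let ?h = "\<lambda>(x, b). r x + (b + b)"
  have lab: "mod2 (r x + (b + b)) = x" if "x \<in> mod2 ` A" for x b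
    using r[OF that, THEN conjunct2]
    by (simp only: additive.add[OF additive_mod2] add_self_bit_fun add_0_right)
  have "card (mod2 ` A \<times> A) \<le> card (A + (A + A))"
  proof (rule card_inj_on_le)
    show "inj_on ?h (mod2 ` A \<times> A)"
    proof (rule inj_onI, clarify)
      fix a b a' b' assume *: "a \<in> A" "a' \<in> A" "r (mod2 a) + (b + b) = r (mod2 a') + (b' + b')"
      then have eq: "mod2 a = mod2 a'" using lab by (metis imageI)
      then have "b + b = b' + b'" using * by simp
      then have "b = b'" by (simp add: fun_eq_iff)
      then show "mod2 a = mod2 a' \<and> b = b'" using eq by simp
    qed
    show "?h ` (mod2 ` A \<times> A) \<subseteq> A + (A + A)"
    proof (clarify)
      fix a b assume "a \<in> A" "b \<in> A"
      then show "r (mod2 a) + (b + b) \<in> A + (A + A)" using r by (intro set_plus_intro) auto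
    qed
    show "finite (A + (A + A))" using A by (simp add: finite_sumset)
  qed
  then have "real (card (mod2 ` A)) * card A \<le> card (A + (A + A))"
    by (simp only: card_cartesian_product flip: of_nat_mult of_nat_le_iff)
  also have "\<dots> \<le> K ^ 4 * card A" by (rule card_triple_sumset_le[OF A K])
  finally show ?thesis using A by (simp add: card_gt_0_iff)
qed

lemma wt_eq_1_iff:
  assumes "finite A" "A \<noteq> {}"
  shows "wt A \<psi> v = 1 \<longleftrightarrow> (\<forall>a\<in>A. \<psi> a = v)"
proof -
  have "wt A \<psi> v = 1 \<longleftrightarrow> card {a\<in>A. \<psi> a = v} = card A"
    using assms by (auto simp: wt_def)
  also have "\<dots> \<longleftrightarrow> {a\<in>A. \<psi> a = v} = A"
    using card_subset_eq[OF assms(1), of "{a\<in>A. \<psi> a = v}"] by (intro iffI) (simp_all only: Collect_subset)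
  finally show ?thesis by blast
qed

lemma affine_dim_le_card:
  assumes "finite I" and A: "\<And>x y. x \<in> A \<Longrightarrow> y \<in> A \<Longrightarrow> x - y \<in> int_span g I"
  shows "affine_dim A \<le> card I"
proof -
  define G where "G i = (\<lambda>k. real_of_int (g i k))" for i
  have "(\<lambda>k. real_of_int (x k - y k)) \<in> seq.span (G ` I)" if xy: "x \<in> A" "y \<in> A" for x y
  proof -
    obtain c where c: "x - y = int_comb g I c" using A[OF xy] by (auto simp: int_span_def)
    have "(\<lambda>k. \<Sum>i\<in>J. real_of_int (c i) * G i k) \<in> seq.span (G ` I)" if "J \<subseteq> I" for J
      using finite_subset[OF that assms(1)] that
    proof (induction J rule: finite_induct)
      case empty
      then show ?case using seq.span_zero[of "G ` I"] by (simp add: zero_fun_def)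
    next
      case (insert j J)
      then have "scale_seq (real_of_int (c j)) (G j) + (\<lambda>k. \<Sum>i\<in>J. real_of_int (c i) * G i k)
          \<in> seq.span (G ` I)"
        by (intro seq.span_add[OF seq.span_scale[OF seq.span_base]]) auto
      moreover have "(\<lambda>k. \<Sum>i\<in>insert j J. real_of_int (c i) * G i k)
          = scale_seq (real_of_int (c j)) (G j) + (\<lambda>k. \<Sum>i\<in>J. real_of_int (c i) * G i k)"
        using insert(1,2) by (simp add: fun_eq_iff scale_seq_def)
      ultimately show ?case by (simp only:)
    qed
    moreover have "real_of_int (x k - y k) = (\<Sum>i\<in>I. real_of_int (c i) * G i k)" for k
      using fun_cong[OF c, of k] by (simp add: int_comb_def G_def)
    ultimately show ?thesis by auto
  qed
  then have "affine_dim A \<le> card (G ` I)"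
    unfolding affine_dim_def using assms(1) by (intro seq.dim_le_card) auto
  then show ?thesis using card_image_le[OF assms(1), of G] by simp
qed

section \<open>From the binary to the integer statement\<close>

text \<open>Closure of \<open>X\<close> under addition carries injectivity over to
  \<open>S + T\<close>; the shifts \<open>a\<close> and \<open>b\<close> merely translate the
  sumset.\<close>

lemma card_sumset_affine_image:
  fixes \<iota> :: "'a::ab_group_add \<Rightarrow> 'b::ab_group_add"
  assumes \<iota>: "Modules.additive \<iota>" "inj_on \<iota> X" and X: "\<forall>x\<in>X. \<forall>y\<in>X. x + y \<in> X"
    and "S \<subseteq> X" "T \<subseteq> X"
  shows "card ((\<lambda>c. \<iota> c + a) ` S + (\<lambda>c. \<iota> c + b) ` T) = card (S + T)"
proof -
  have "(\<lambda>c. \<iota> c + a) ` S + (\<lambda>c. \<iota> c + b) ` T = (\<lambda>c. \<iota> c + (a + b)) ` (S + T)"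
    by (force simp: set_plus_def additive.add[OF \<iota>(1)] algebra_simps)
  moreover have "S + T \<subseteq> X" using assms(4,5) X by (auto simp: set_plus_def)
  then have "inj_on (\<lambda>c. \<iota> c + (a + b)) (S + T)"
    using \<iota>(2) by (auto simp: inj_on_def)
  ultimately show ?thesis by (simp add: card_image)
qed

lemma regular_pair_affine_preimage:
  fixes \<iota> :: "'a::ab_group_add \<Rightarrow> 'b::ab_group_add"
  assumes \<iota>: "Modules.additive \<iota>" "inj_on \<iota> X" and X: "\<forall>x\<in>X. \<forall>y\<in>X. x + y \<in> X"
    and A: "A \<subseteq> X" and B: "B \<subseteq> X"
    and reg: "regular_pair \<theta> ((\<lambda>c. \<iota> c + a) ` A) ((\<lambda>c. \<iota> c + b) ` B)"
  shows "regular_pair \<theta> A B"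
proof -
  have inj: "inj_on (\<lambda>c. \<iota> c + u) S" if "S \<subseteq> X" for S u
    using that \<iota>(2) by (auto simp: inj_on_def)
  note R = regular_pairD[OF reg]
  show ?thesis
    unfolding regular_pair_def
  proof (intro conjI allI impI)
    show "finite A" "finite B" using R(1,2) inj A B by (auto dest: finite_imageD)
    show "A \<noteq> {}" "B \<noteq> {}" using R(3,4) by auto
    fix S T assume ST: "S \<subseteq> A" "T \<subseteq> B" "S \<noteq> {}" "T \<noteq> {}"
    have SX: "S \<subseteq> X" "T \<subseteq> X" using ST A B by auto
    show "card (A + B) * (card S / card A * (card T / card B)) powr \<theta> \<le> card (S + T)"
      using R(5)[of "(\<lambda>c. \<iota> c + a) ` S" "(\<lambda>c. \<iota> c + b) ` T"] ST SX A B
      by (simp add: card_sumset_affine_image[OF \<iota> X] card_image inj image_mono)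
  qed
qed

text \<open>In a basis of the lattice generated by the translates of \<open>A\<close> by
  \<open>- a0\<close> and of \<open>B\<close> by \<open>- b0\<close>, no nonzero character modulo 2
  is constant on both sets, so the rank bound applies to \<open>mod2\<close>. The second conclusion
  handles \<open>K\<close> near 1, where the constant \<open>k0\<close> could not be
  absorbed.\<close>

lemma affine_dim_bound:
  fixes A B :: "(nat \<Rightarrow> int) set" and K :: real
  assumes c: "0 < c" "pfr_with c" and \<tau>: "0 < \<tau>" "\<tau> \<le> 1 / 40" "40 * c * \<tau> \<le> 1"
    and p0: "0 < p0" "p0 < 1" "p0 powr (\<tau> / 4) \<le> 1 / 8"
    and \<eta>: "0 \<le> \<eta>" "1 / 2 ^ k0 + 2 * \<eta> \<le> p0" and bal: "balancing \<theta> \<eta>" and adm: "admissible \<tau> \<theta>"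
    and reg: "regular_pair \<theta> A B"
    and KA: "real (card (A + A)) \<le> K * card A" and KB: "real (card (B + B)) \<le> K * card B"
  shows "2 ^ affine_dim A \<le> 2 ^ k0 * K ^ 16 \<and> (K ^ 4 < 2 \<longrightarrow> affine_dim A = 0)"
proof -
  note AB = regular_pairD[OF reg]
  obtain a0 b0 where a0: "a0 \<in> A" and b0: "b0 \<in> B" using AB(3,4) by blast
  define S where "S = (\<lambda>a. a - a0) ` A \<union> (\<lambda>b. b - b0) ` B"
  have "finite S" using AB by (simp add: S_def)
  then obtain n :: nat and s where s: "S = s ` {i. i < n}"
    using finite_imp_nat_seg_image_inj_on by metis
  obtain I g where I: "I \<subseteq> {i. i < n}" and span: "int_span g I = int_span s {i. i < n}"
    and indep: "\<And>c. int_comb g I c = 0 \<Longrightarrow> \<forall>i\<in>I. c i = 0"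
    using int_span_basis_exists[of "{i. i < n}" s] by auto
  have finI: "finite I" using I finite_subset by auto
  let ?X = "supp_space I :: (nat \<Rightarrow> int) set"
  let ?\<iota> = "int_comb g I"
  note \<iota>_add = additive_int_comb[of g I]
  have inj: "inj_on ?\<iota> ?X"
  proof (rule inj_onI)
    fix x y assume xy: "x \<in> ?X" "y \<in> ?X" "?\<iota> x = ?\<iota> y"
    then have "?\<iota> (x - y) = 0" by (simp add: additive.diff[OF \<iota>_add])
    then have "\<forall>i\<in>I. (x - y) i = 0" by (rule indep)
    then show "x = y" using xy by (auto simp: supp_space_def fun_eq_iff)
  qed
  have lift: "\<exists>c\<in>?X. ?\<iota> c = x" if x: "x \<in> int_span g I" for x
  proof -
    obtain c where "x = ?\<iota> c" using x by (auto simp: int_span_def)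
    then have "?\<iota> (\<lambda>i. if i \<in> I then c i else 0) = x" by (simp add: int_comb_def)
    then show ?thesis by (intro bexI[of _ "\<lambda>i. if i \<in> I then c i else 0"]) (auto simp: supp_space_def)
  qed
  have S_span: "x \<in> int_span g I" if "x \<in> S" for x
    using that int_span_base[of "{i. i < n}" _ s] by (auto simp: s span)
  have X_add: "\<forall>x\<in>?X. \<forall>y\<in>?X. x + y \<in> ?X" by (simp add: supp_space_add)
  define A' where "A' = {c\<in>?X. ?\<iota> c + a0 \<in> A}"
  define B' where "B' = {c\<in>?X. ?\<iota> c + b0 \<in> B}"
  have sub: "A' \<subseteq> ?X" "B' \<subseteq> ?X" by (auto simp: A'_def B'_def)
  have A'_img: "(\<lambda>c. ?\<iota> c + a0) ` A' = A"
  proof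
    show "A \<subseteq> (\<lambda>c. ?\<iota> c + a0) ` A'"
    proof
      fix a assume a: "a \<in> A"
      then obtain c where "c \<in> ?X" "?\<iota> c = a - a0" using lift[OF S_span] by (auto simp: S_def)
      then show "a \<in> (\<lambda>c. ?\<iota> c + a0) ` A'" using a by (intro image_eqI[of _ _ c]) (auto simp: A'_def)
    qed
  qed (auto simp: A'_def)
  have B'_img: "(\<lambda>c. ?\<iota> c + b0) ` B' = B"
  proof
    show "B \<subseteq> (\<lambda>c. ?\<iota> c + b0) ` B'"
    proof
      fix b assume b: "b \<in> B"
      then obtain c where "c \<in> ?X" "?\<iota> c = b - b0" using lift[OF S_span] by (auto simp: S_def)
      then show "b \<in> (\<lambda>c. ?\<iota> c + b0) ` B'" using b by (intro image_eqI[of _ _ c]) (auto simp: B'_def)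
    qed
  qed (auto simp: B'_def)
  have "regular_pair \<theta> ((\<lambda>c. ?\<iota> c + a0) ` A') ((\<lambda>c. ?\<iota> c + b0) ` B')"
    unfolding A'_img B'_img by (rule reg)
  then have reg': "regular_pair \<theta> A' B'"
    by (rule regular_pair_affine_preimage[OF \<iota>_add inj X_add sub])
  note AB' = regular_pairD[OF reg']
  have "card A' = card A"
    using card_image[of "\<lambda>c. ?\<iota> c + a0" A'] inj sub A'_img by (auto simp: inj_on_def subset_iff)
  moreover have "card (A' + A') = card (A + A)"
    using card_sumset_affine_image[OF \<iota>_add inj X_add sub(1) sub(1), of a0 a0] A'_img by simp
  ultimately have cA: "real (card (mod2 ` A')) \<le> K ^ 4"
    using KA AB' by (intro card_mod2_image_le) auto
  have "card B' = card B"
    using card_image[of "\<lambda>c. ?\<iota> c + b0" B'] inj sub B'_img by (auto simp: inj_on_def subset_iff)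
  moreover have "card (B' + B') = card (B + B)"
    using card_sumset_affine_image[OF \<iota>_add inj X_add sub(2) sub(2), of b0 b0] B'_img by simp
  ultimately have cB: "real (card (mod2 ` B')) \<le> K ^ 4"
    using KB AB' by (intro card_mod2_image_le) auto
  have zero: "0 \<in> A'" "0 \<in> B'"
    using a0 b0 additive.zero[OF \<iota>_add] by (auto simp: A'_def B'_def supp_space_def)
  have gen: "\<forall>x\<in>supp_space I. \<chi> x = 0"
    if \<chi>: "Modules.additive \<chi>" and v: "wt A' (\<chi> \<circ> mod2) v = 1" and w: "wt B' (\<chi> \<circ> mod2) w = 1"
    for \<chi> :: "(nat \<Rightarrow> bit) \<Rightarrow> bit" and v w
  proof -
    define f where "f = \<chi> \<circ> mod2"
    have f: "Modules.additive f"
      using additive.add[OF \<chi>] additive.add[OF additive_mod2] by (simp add: Modules.additive_def f_def)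
    have fA: "f x = 0" if "x \<in> A'" for x
      using v wt_eq_1_iff[OF AB'(1,3)] that zero(1) additive.zero[OF f] unfolding f_def by metis
    have fB: "f x = 0" if "x \<in> B'" for x
      using w wt_eq_1_iff[OF AB'(2,4)] that zero(2) additive.zero[OF f] unfolding f_def by metis
    \<comment> \<open>\<open>M\<close> is the sublattice on which \<open>f\<close> vanishes. It
      contains all generators, hence is everything, and every residue lifts to it.\<close>
    define M where "M = {u. \<exists>c\<in>?X. ?\<iota> c = u \<and> f c = 0}"
    have "int_span s {i. i < n} \<subseteq> M"
    proof (rule int_span_least)
      have "?\<iota> 0 = 0" "f 0 = 0" by (rule additive.zero[OF \<iota>_add], rule additive.zero[OF f])
      moreover have "0 \<in> ?X" by (simp add: supp_space_def)
      ultimately show "0 \<in> M" unfolding M_def by blast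
    next
      fix x y assume "x \<in> M" "y \<in> M"
      then obtain d e where "d \<in> ?X" "e \<in> ?X" "?\<iota> d = x" "?\<iota> e = y" "f d = 0" "f e = 0"
        by (auto simp: M_def)
      then have "d + e \<in> ?X" "?\<iota> (d + e) = x + y" "f (d + e) = 0"
        by (simp_all add: supp_space_add additive.add[OF \<iota>_add] additive.add[OF f])
      then show "x + y \<in> M" unfolding M_def by blast
    next
      fix x assume "x \<in> M"
      then obtain d where "d \<in> ?X" "?\<iota> d = x" "f d = 0" by (auto simp: M_def)
      then have "- d \<in> ?X" "?\<iota> (- d) = - x" "f (- d) = 0"
        by (simp_all add: supp_space_def additive.minus[OF \<iota>_add] additive.minus[OF f])
      then show "- x \<in> M" unfolding M_def by blast
    next
      fix i assume "i \<in> {i. i < n}"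
      then have "s i \<in> S" by (simp add: s)
      then obtain d where d: "d \<in> ?X" "?\<iota> d = s i" using lift[OF S_span] by blast
      have "d \<in> A' \<or> d \<in> B'" using \<open>s i \<in> S\<close> d by (auto simp: S_def A'_def B'_def)
      then have "f d = 0" using fA fB by blast
      then show "s i \<in> M" using d unfolding M_def by blast
    qed simp
    then have sM: "int_span g I \<subseteq> M" using span by simp
    show ?thesis
    proof
      fix x :: "nat \<Rightarrow> bit" assume "x \<in> supp_space I"
      then obtain d where d: "d \<in> ?X" "mod2 d = x" using mod2_supp_space by (metis imageE)
      have "?\<iota> d \<in> M" using sM by (auto simp: int_span_def)
      then obtain e where e: "e \<in> ?X" "?\<iota> e = ?\<iota> d" "f e = 0" by (auto simp: M_def)
      then have "e = d" using inj d(1) by (auto dest: inj_onD)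
      then show "\<chi> x = 0" using e(3) d(2) by (simp add: f_def)
    qed
  qed
  have modI: "mod2 ` A' \<subseteq> supp_space I" using sub(1) mod2_supp_space by blast
  have "finite (mod2 ` A')" "mod2 ` A' \<noteq> {}" using AB' by auto
  then obtain x0 where x0: "x0 \<in> mod2 ` A'" "\<And>y. y \<in> mod2 ` A' \<Longrightarrow> wt A' mod2 y \<le> wt A' mod2 x0"
    using ex_is_arg_min_if_finite[of "mod2 ` A'" "\<lambda>y. - wt A' mod2 y"] by (auto simp: is_arg_min_linorder)
  have w0: "0 < wt A' mod2 x0" using x0(1) AB' by (intro wt_pos)
  \<comment> \<open>There are at most \<open>K ^ 4\<close> classes, so the heaviest has weight at
    least \<open>1 / K ^ 4\<close>; the fourth power in the potential gives the exponent 16.\<close>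
  have "1 = (\<Sum>y\<in>mod2 ` A'. wt A' mod2 y)" using AB' by (intro sum_wt[symmetric]) auto
  also have "\<dots> \<le> card (mod2 ` A') * wt A' mod2 x0" using x0(2) by (rule sum_bounded_above)
  also have "\<dots> \<le> K ^ 4 * wt A' mod2 x0" using cA by (intro mult_right_mono) auto
  finally have "1 ^ 4 \<le> (K ^ 4 * wt A' mod2 x0) ^ 4" by (intro power_mono) auto
  then have K16: "1 \<le> K ^ 16 * wt A' mod2 x0 ^ 4" by (simp add: power_mult_distrib flip: power_mult)
  have rank: "2 ^ card I * wt A' mod2 x0 ^ 4 \<le> 2 ^ k0"
    by (rule rank_le_of_regular_pair[OF c \<tau> p0 \<eta> bal adm reg' additive_mod2 finI modI _ w0])
      (rule gen; assumption)
  have "(2::real) ^ card I * 1 \<le> 2 ^ card I * (K ^ 16 * wt A' mod2 x0 ^ 4)"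
    using K16 by (intro mult_left_mono) auto
  also have "\<dots> = (2 ^ card I * wt A' mod2 x0 ^ 4) * K ^ 16" by simp
  also have "\<dots> \<le> 2 ^ k0 * K ^ 16" using rank by (intro mult_right_mono) auto
  finally have cI: "2 ^ card I \<le> 2 ^ k0 * K ^ 16" by simp
  have dim: "affine_dim A \<le> card I"
  proof (rule affine_dim_le_card[OF finI])
    fix x y assume "x \<in> A" "y \<in> A"
    then have "(x - a0) + - (y - a0) \<in> int_span g I"
      by (intro int_span_add int_span_uminus S_span) (auto simp: S_def)
    then show "x - y \<in> int_span g I" by simp
  qed
  have "(2::real) ^ affine_dim A \<le> 2 ^ card I" using dim by (intro power_increasing) auto
  then have "2 ^ affine_dim A \<le> 2 ^ k0 * K ^ 16" using cI by (rule order_trans)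
  \<comment> \<open>Each set now lies in a single class modulo 2, so every coordinate is constant on
    both, and \<open>gen\<close> leaves no coordinate.\<close>
  moreover have "I = {}" if K4: "K ^ 4 < 2"
  proof (rule ccontr)
    assume "I \<noteq> {}"
    then obtain i where i: "i \<in> I" by blast
    have const: "\<exists>v. \<forall>a\<in>C. mod2 a = v" if "C \<noteq> {}" "real (card (mod2 ` C)) < 2" "finite C" for C
    proof -
      have "card (mod2 ` C) > 0" using that by (simp add: card_gt_0_iff)
      then have "card (mod2 ` C) = 1" using that(2) by simp
      then show ?thesis by (metis card_1_singletonE imageI singletonD)
    qed
    obtain v where v: "\<forall>a\<in>A'. mod2 a = v" using const[of A'] AB'(1,3) cA K4 by auto
    obtain w where w: "\<forall>a\<in>B'. mod2 a = w" using const[of B'] AB'(2,4) cB K4 by auto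
    define \<chi> where "\<chi> x = x i" for x :: "nat \<Rightarrow> bit"
    have "\<forall>x\<in>supp_space I. \<chi> x = 0"
    proof (rule gen)
      show "Modules.additive \<chi>" by (simp add: Modules.additive_def \<chi>_def)
      show "wt A' (\<chi> \<circ> mod2) (\<chi> v) = 1" using v AB' by (simp add: wt_eq_1_iff)
      show "wt B' (\<chi> \<circ> mod2) (\<chi> w) = 1" using w AB' by (simp add: wt_eq_1_iff)
    qed
    moreover have "(\<lambda>j. if j = i then 1 else 0) \<in> supp_space I" using i by (auto simp: supp_space_def)
    ultimately show False by (force simp: \<chi>_def)
  qed
  ultimately show ?thesis using dim by auto
qed

theorem corollary1p12:
  assumes PFR_F2
  shows weak_PFR_Z
proof -
  obtain c where c: "0 < c" "pfr_with c" using assms by (auto simp: PFR_F2_iff_pfr_with)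
  obtain \<tau> p0 \<eta> \<theta> k0 where const: "0 < \<tau>" "\<tau> \<le> 1 / 40" "40 * c * \<tau> \<le> 1" "0 < p0" "p0 < 1"
    "p0 powr (\<tau> / 4) \<le> 1 / 8" "0 \<le> \<eta>" "1 / 2 ^ k0 + 2 * \<eta> \<le> p0" "balancing \<theta> \<eta>" "admissible \<tau> \<theta>"
    using constants_exist[OF c(1)] by blast
  define \<epsilon> where "\<epsilon> = \<theta> - 1 / 2"
  have \<epsilon>: "0 < \<epsilon>" "\<theta> = 1 / 2 + \<epsilon>" using const(10) by (auto simp: \<epsilon>_def admissible_def)
  \<comment> \<open>Passing to a subset of relative size \<open>K powr - (1 / \<epsilon>)\<close>
    raises the doubling bound from \<open>K\<close> to at most
    \<open>K * K powr (1 / \<epsilon>) = K powr m\<close>.\<close>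
  define m where "m = 1 + 1 / \<epsilon>"
  have m0: "0 < m" using \<epsilon> by (simp add: m_def add_pos_pos)
  show ?thesis
    unfolding weak_PFR_Z_def
  \<comment> \<open>The factor \<open>m\<close> comes from \<open>ln L = m * ln K\<close>, the 16
    from the exponent of \<open>L\<close> in the dimension bound, and \<open>4 * real k0\<close>
    from absorbing \<open>k0\<close> when \<open>2 \<le> L ^ 4\<close>.\<close>
  proof (rule exI[of _ "1 / \<epsilon>"], rule exI[of _ "(4 * real k0 + 16) * m / ln 2"], intro allI impI)
    fix D :: nat and K :: real and A :: "(nat \<Rightarrow> int) set"
    assume A: "finite A" "A \<noteq> {}" and K: "doubling A \<le> K"
    have A0: "0 < real (card A)" using A by (simp add: card_gt_0_iff)
    have KA: "real (card (A + A)) \<le> K * card A" using K A0 by (simp add: doubling_def pos_divide_le_eq)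
    have "card A \<le> card (A + A)" using A by (intro card_le_sumset)
    then have "1 * real (card A) \<le> K * card A" using KA by simp
    then have K1: "1 \<le> K" using A0 by (simp only: mult_le_cancel_right_pos)
    obtain A' B' where sub: "A' \<subseteq> A" "B' \<subseteq> A" and reg: "regular_pair \<theta> A' B'"
      and size: "K powr - (1 / \<epsilon>) * card A \<le> card A'" "K powr - (1 / \<epsilon>) * card A \<le> card B'"
      using regular_pair_exists[OF A KA \<epsilon>(1)] \<epsilon>(2) by blast
    define L where "L = K powr m"
    have L1: "1 \<le> L" using K1 m0 by (simp add: L_def ge_one_powr_ge_zero)
    have "real (card (S + S)) \<le> L * card S" if S: "S \<subseteq> A" "K powr - (1 / \<epsilon>) * card A \<le> card S" for S
    proof -
      have "real (card (S + S)) \<le> card (A + A)"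
        using S A by (intro of_nat_mono card_mono finite_sumset set_plus_mono2) auto
      also have "\<dots> \<le> L * (K powr - (1 / \<epsilon>) * card A)"
      proof -
        have "L * K powr - (1 / \<epsilon>) = K" using K1 by (simp add: L_def m_def flip: powr_add)
        then show ?thesis using KA by (simp flip: mult.assoc)
      qed
      also have "\<dots> \<le> L * card S" using S(2) L1 by (intro mult_left_mono) auto
      finally show ?thesis .
    qed
    then have "2 ^ affine_dim A' \<le> 2 ^ k0 * L ^ 16" and small: "L ^ 4 < 2 \<longrightarrow> affine_dim A' = 0"
      using affine_dim_bound[OF c const reg] sub size by blast+
    then have "ln (2 ^ affine_dim A') \<le> ln (2 ^ k0 * L ^ 16)" using L1 by (subst ln_le_cancel_iff) auto
    also have "\<dots> = k0 * ln 2 + 16 * ln L" using L1 by (simp add: ln_mult ln_realpow)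
    finally have le: "affine_dim A' * ln 2 \<le> k0 * ln 2 + 16 * ln L" by (simp add: ln_realpow)
    have lnL: "ln L = m * ln K" using K1 by (simp add: L_def ln_powr)
    have "affine_dim A' * ln 2 \<le> (4 * real k0 + 16) * m * ln K"
    \<comment> \<open>The additive term \<open>k0 * ln 2\<close> is not bounded by a multiple of
      \<open>ln K\<close> near \<open>K = 1\<close>; there the dimension is zero, and otherwise
      \<open>ln 2 \<le> 4 * ln L\<close>.\<close>
    proof (cases "L ^ 4 < 2")
      case True
      then show ?thesis using small m0 K1 by simp
    next
      case False
      then have "ln 2 \<le> ln (L ^ 4)" using L1 by (subst ln_le_cancel_iff) auto
      then have "ln 2 \<le> 4 * ln L" using L1 by (simp add: ln_realpow)
      then have "k0 * ln 2 \<le> k0 * (4 * ln L)" by (intro mult_left_mono) auto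
      then show ?thesis using le lnL by (simp add: algebra_simps)
    qed
    then have "affine_dim A' \<le> (4 * real k0 + 16) * m / ln 2 * ln K" by (simp add: field_simps)
    then show "\<exists>A'\<subseteq>A. K powr - (1 / \<epsilon>) * card A \<le> card A' \<and>
        affine_dim A' \<le> (4 * real k0 + 16) * m / ln 2 * ln K"
      using sub(1) size(1) by blast
  qed
qed

end
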